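(* Let $\tau$ be a reasonable substitution with generating fixed point $u$, and suppose that $\tau$ is $M$-quasi-invertible with branch point $y$. Then there exists a semi-proper, stationary Bratteli diagram $\mathcal B$ such that $(X_{\mathcal B},V_{\mathcal B})$ is topologically conjugate to $(X_\tau,\sigma)$.
   Context: **Substitutions.** $\mathcal A$ is a finite alphabet, $\mathcal A^+$ the set of nonempty finite words, $\mathbb N=\{0,1,\dots\}$, $|w|$ the length of a word $w$. $\mathcal A^{\mathbb N}$ carries the product topology and $\sigma$ is the left shift, $(\sigma x)_m=x_{m+1}$. A substitution is a map $\tau:\mathcal A\to\mathcal A^+$, extended by concatenation to words and to one-sided sequences. $\mathcal L_\tau$ is the set of all subwords of the words $\tau^n(a)$, $n\ge 1$, $a\in\mathcal A$; $X_\tau\subset\mathcal A^{\mathbb N}$ is the set of sequences all of whose finite subwords lie in $\mathcal L_\tau$. A fixed point of $\tau$ is $u\in\mathcal A^{\mathbb N}$ with $\tau(u)=u$; it is generating if the set of words occurring in $u$ equals $\mathcal L_\tau$ and $|\tau^n(u_0)|\to\infty$. $\tau$ is minimal if it has a generating fixed point $u$ and $(X_\tau,\sigma)$ is minimal (every forward orbit is dense in $X_\tau$). $\tau$ is injective if $\tau(a)\ne\tau(b)$ for $a\neq b$ in $\mathcal A$. With $E=\{0\}\cup\{|\tau(u_0\cdots u_{p-1})|:p>0\}$, $\tau$ is (unilaterally) recognizable if there is $L$ such that $u_i\cdots u_{i+L-1}=u_j\cdots u_{j+L-1}$ and $i\in E$ imply $j\in E$. $\tau$ is reasonable if it is minimal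 and recognizable and all powers $\tau^n$, $n\ge1$, are injective as substitutions. **Quasi-invertibility.** A point of a system $(Y,T)$ is a branch point if it has more than one $T$-preimage in $Y$, and an $M$-branch point if it has exactly $M\geq 2$ preimages. $(Y,T)$ is quasi-invertible if it has exactly one branch point; $\tau$ is $M$-quasi-invertible if $(X_\tau,\sigma)$ is quasi-invertible and its branch point is an $M$-branch point. **Bratteli diagrams.** A Bratteli diagram $\mathcal B=(\mathcal V,\mathcal E)$ has vertex set $\bigsqcup_{n\ge0}\mathcal V_n$ and edge set $\bigsqcup_{n\ge1}\mathcal E_n$, all $\mathcal V_n,\mathcal E_n$ finite, $\mathcal V_0=\{v_0\}$; each $x\in\mathcal E_n$ has source $s(x)\in\mathcal V_{n-1}$ and range $r(x)\in\mathcal V_n$; $s^{-1}(v)\ne\emptyset$ for all $v$ and $r^{-1}(v)\neq\emptyset$ for $v\ne v_0$. $X_{\mathcal B}\subset\prod_{n\geq 1}\mathcal E_n$ is the space of infinite paths $(x_n)_{n\ge1}$ with $s(x_{n+1})=r(x_n)$, with the induced product topology. $\mathcal B$ is simple if it has a telescoping (passing to a subsequence of levels $0=n_0<n_1<\cdots$, with edges being the paths between the chosen levels) in which every vertex of level $n\geq1$ is joined by at least one edge to every vertex of level $n+1$. $\mathcal B$ is ordered if each set $\mathcal E_n(a)=\{x\in\mathcal E_n:r(x)=a\}$ is linearly ordered. A path is maximal (minimal) if all its edges are maximal (minimal). If $x=(x_n)$ is not maximal, let $k$ be least with $x_k$ not maximal and $y_k$ the successor of $x_k$ in $\mathcal E_k(r(x_k))$;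 then $V_{\mathcal B}(x)$ is the path that agrees with $x$ at levels $>k$, has $k$-th edge $y_k$, and below level $k$ is the unique minimal path from $v_0$ to $s(y_k)$. $\mathcal B$ is semi-proper if it is a simple ordered diagram with a unique minimal path $x_{\min}$; then $V_{\mathcal B}$ is extended to a continuous surjection of $X_{\mathcal B}$ by sending every maximal path to $x_{\min}$. $\mathcal B$ is stationary if the vertex sets $\mathcal V_n$ ($n\ge1$) can be identified with one another so that all $\mathcal E_n$, $n\ge2$, are the same as ordered edge sets (no condition on $\mathcal E_1$). *)

theory Defs
  imports "HOL-Analysis.Analysis" "HOL-Library.Sublist"
begin

section \<open>Topological dynamical systems\<close>

definition minimal_system :: "'x topology \<Rightarrow> ('x \<Rightarrow> 'x) \<Rightarrow> bool" where
  "minimal_system Y T \<longleftrightarrow>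
     (\<forall>x\<in>topspace Y. Y closure_of (range (\<lambda>n::nat. (T ^^ n) x)) = topspace Y)"

definition topologically_conjugate ::
  "'x topology \<Rightarrow> ('x \<Rightarrow> 'x) \<Rightarrow> 'y topology \<Rightarrow> ('y \<Rightarrow> 'y) \<Rightarrow> bool" where
  "topologically_conjugate Y T Z S \<longleftrightarrow>
     (\<exists>h. homeomorphic_map Y Z h \<and> (\<forall>x\<in>topspace Y. h (T x) = S (h x)))"

definition preimages :: "'x topology \<Rightarrow> ('x \<Rightarrow> 'x) \<Rightarrow> 'x \<Rightarrow> 'x set" where
  "preimages Y T y = {z \<in> topspace Y. T z = y}"

definition branch_point :: "'x topology \<Rightarrow> ('x \<Rightarrow> 'x) \<Rightarrow> 'x \<Rightarrow> bool" where
  "branch_point Y T y \<longleftrightarrow>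
     y \<in> topspace Y \<and> (\<exists>z\<in>preimages Y T y. \<exists>z'\<in>preimages Y T y. z \<noteq> z')"

text \<open>Since \<open>M \<ge> 2\<close>, the cardinality condition forces the set of preimages to be finite.\<close>

definition M_branch_point :: "nat \<Rightarrow> 'x topology \<Rightarrow> ('x \<Rightarrow> 'x) \<Rightarrow> 'x \<Rightarrow> bool" where
  "M_branch_point M Y T y \<longleftrightarrow>
     y \<in> topspace Y \<and> M \<ge> 2 \<and> card (preimages Y T y) = M"

definition quasi_invertible :: "'x topology \<Rightarrow> ('x \<Rightarrow> 'x) \<Rightarrow> bool" where
  "quasi_invertible Y T \<longleftrightarrow> (\<exists>!y. branch_point Y T y)"

section \<open>Substitutions\<close>

definition substitution :: "('a \<Rightarrow> 'a list) \<Rightarrow> bool" where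
  "substitution \<tau> \<longleftrightarrow> (\<forall>a. \<tau> a \<noteq> [])"

definition subst_word :: "('a \<Rightarrow> 'a list) \<Rightarrow> 'a list \<Rightarrow> 'a list" where
  "subst_word \<tau> w = concat (map \<tau> w)"

definition subst_pow :: "('a \<Rightarrow> 'a list) \<Rightarrow> nat \<Rightarrow> 'a \<Rightarrow> 'a list" where
  "subst_pow \<tau> n a = (subst_word \<tau> ^^ n) [a]"

text \<open>\<open>factor x i l\<close> is the word \<open>x i \<dots> x (i + l - 1)\<close>.\<close>

definition factor :: "(nat \<Rightarrow> 'a) \<Rightarrow> nat \<Rightarrow> nat \<Rightarrow> 'a list" where
  "factor x i l = map x [i..<i + l]"

definition factors :: "(nat \<Rightarrow> 'a) \<Rightarrow> 'a list set" where
  "factors x = {factor x i l | i l. True}"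

text \<open>The infinite concatenation of the words \<open>\<tau> (x 0)\<close>, \<open>\<tau> (x 1)\<close>, \dots.  As these words are
  nonempty, the first \<open>m + 1\<close> of them already determine the letter at position \<open>m\<close>.\<close>

definition subst_seq :: "('a \<Rightarrow> 'a list) \<Rightarrow> (nat \<Rightarrow> 'a) \<Rightarrow> nat \<Rightarrow> 'a" where
  "subst_seq \<tau> x m = subst_word \<tau> (factor x 0 (Suc m)) ! m"

definition shift :: "(nat \<Rightarrow> 'a) \<Rightarrow> nat \<Rightarrow> 'a" where
  "shift x m = x (Suc m)"

definition lang :: "('a \<Rightarrow> 'a list) \<Rightarrow> 'a list set" where
  "lang \<tau> = {w. \<exists>n\<ge>1. \<exists>a. sublist w (subst_pow \<tau> n a)}"

definition subshift :: "('a \<Rightarrow> 'a list) \<Rightarrow> (nat \<Rightarrow> 'a) set" where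
  "subshift \<tau> = {x. factors x \<subseteq> lang \<tau>}"

definition subshift_topology :: "('a \<Rightarrow> 'a list) \<Rightarrow> (nat \<Rightarrow> 'a) topology" where
  "subshift_topology \<tau> =
     subtopology (product_topology (\<lambda>_. discrete_topology UNIV) UNIV) (subshift \<tau>)"

definition generating_fixed_point :: "('a \<Rightarrow> 'a list) \<Rightarrow> (nat \<Rightarrow> 'a) \<Rightarrow> bool" where
  "generating_fixed_point \<tau> u \<longleftrightarrow>
     subst_seq \<tau> u = u \<and>
     factors u = lang \<tau> \<and>
     filterlim (\<lambda>n. length (subst_pow \<tau> n (u 0))) at_top sequentially"

definition minimal_substitution :: "('a \<Rightarrow> 'a list) \<Rightarrow> bool" where
  "minimal_substitution \<tau> \<longleftrightarrow>
     (\<exists>u. generating_fixed_point \<tau> u) \<and> minimal_system (subshift_topology \<tau>) shift"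

definition cutting_points :: "('a \<Rightarrow> 'a list) \<Rightarrow> (nat \<Rightarrow> 'a) \<Rightarrow> nat set" where
  "cutting_points \<tau> u = {0} \<union> {length (subst_word \<tau> (factor u 0 p)) | p. p > 0}"

text \<open>A substitution may have several generating fixed points, so the fixed point that
  recognizability refers to is an explicit argument.\<close>

definition recognizable :: "('a \<Rightarrow> 'a list) \<Rightarrow> (nat \<Rightarrow> 'a) \<Rightarrow> bool" where
  "recognizable \<tau> u \<longleftrightarrow>
     (\<exists>L. \<forall>i j. factor u i L = factor u j L \<and> i \<in> cutting_points \<tau> u
              \<longrightarrow> j \<in> cutting_points \<tau> u)"

definition reasonable :: "('a \<Rightarrow> 'a list) \<Rightarrow> (nat \<Rightarrow> 'a) \<Rightarrow> bool" where
  "reasonable \<tau> u \<longleftrightarrow>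
     minimal_substitution \<tau> \<and> recognizable \<tau> u \<and> (\<forall>n\<ge>1. inj (subst_pow \<tau> n))"

definition M_quasi_invertible :: "nat \<Rightarrow> ('a \<Rightarrow> 'a list) \<Rightarrow> bool" where
  "M_quasi_invertible M \<tau> \<longleftrightarrow>
     quasi_invertible (subshift_topology \<tau>) shift \<and>
     (\<forall>y. branch_point (subshift_topology \<tau>) shift y
          \<longrightarrow> M_branch_point M (subshift_topology \<tau>) shift y)"

section \<open>Bratteli diagrams\<close>

text \<open>All data are indexed by the level, which realizes the disjoint unions of vertex and edge sets.
  \<open>edges B n\<close>, \<open>src B n\<close> and \<open>rng B n\<close> are only meaningful for \<open>n \<ge> 1\<close>.\<close>

record ('v, 'e) bratteli =
  verts :: "nat \<Rightarrow> 'v set"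
  edges :: "nat \<Rightarrow> 'e set"
  src :: "nat \<Rightarrow> 'e \<Rightarrow> 'v"
  rng :: "nat \<Rightarrow> 'e \<Rightarrow> 'v"

definition bratteli_diagram :: "('v, 'e, 'z) bratteli_scheme \<Rightarrow> bool" where
  "bratteli_diagram B \<longleftrightarrow>
     (\<exists>v0. verts B 0 = {v0}) \<and>
     (\<forall>n. finite (verts B n)) \<and>
     (\<forall>n\<ge>1. finite (edges B n)) \<and>
     (\<forall>n\<ge>1. \<forall>e\<in>edges B n. src B n e \<in> verts B (n - 1) \<and> rng B n e \<in> verts B n) \<and>
     (\<forall>n. \<forall>v\<in>verts B n. \<exists>e\<in>edges B (n + 1). src B (n + 1) e = v) \<and>
     (\<forall>n\<ge>1. \<forall>v\<in>verts B n. \<exists>e\<in>edges B n. rng B n e = v)"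

definition path_space :: "('v, 'e, 'z) bratteli_scheme \<Rightarrow> (nat \<Rightarrow> 'e) set" where
  "path_space B =
     {x \<in> Pi\<^sub>E {1..} (edges B). \<forall>n\<ge>1. src B (n + 1) (x (n + 1)) = rng B n (x n)}"

definition path_topology :: "('v, 'e, 'z) bratteli_scheme \<Rightarrow> (nat \<Rightarrow> 'e) topology" where
  "path_topology B =
     subtopology (product_topology (\<lambda>n. discrete_topology (edges B n)) {1..}) (path_space B)"

text \<open>Finite paths from level \<open>m\<close> to level \<open>n\<close>: the \<open>i\<close>-th entry is an edge of level \<open>m + i + 1\<close>.\<close>

definition finite_paths :: "('v, 'e, 'z) bratteli_scheme \<Rightarrow> nat \<Rightarrow> nat \<Rightarrow> 'e list set" where
  "finite_paths B m n =
     {p. length p = n - m \<and>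
         (\<forall>i<length p. p ! i \<in> edges B (m + i + 1)) \<and>
         (\<forall>i. i + 1 < length p \<longrightarrow>
            src B (m + i + 2) (p ! (i + 1)) = rng B (m + i + 1) (p ! i))}"

definition telescope ::
  "('v, 'e, 'z) bratteli_scheme \<Rightarrow> (nat \<Rightarrow> nat) \<Rightarrow> ('v, 'e list) bratteli" where
  "telescope B l =
     \<lparr> verts = (\<lambda>k. verts B (l k)),
       edges = (\<lambda>k. finite_paths B (l (k - 1)) (l k)),
       src = (\<lambda>k p. src B (l (k - 1) + 1) (hd p)),
       rng = (\<lambda>k p. rng B (l k) (last p)) \<rparr>"

definition simple_diagram :: "('v, 'e, 'z) bratteli_scheme \<Rightarrow> bool" where
  "simple_diagram B \<longleftrightarrow>
     (\<exists>l. strict_mono l \<and> l 0 = 0 \<and>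
        (let C = telescope B l in
          \<forall>n\<ge>1. \<forall>v\<in>verts C n. \<forall>w\<in>verts C (n + 1).
            \<exists>e\<in>edges C (n + 1). src C (n + 1) e = v \<and> rng C (n + 1) e = w))"

text \<open>\<open>edge_ord B n a\<close> is the (reflexive) linear order on the edges of level \<open>n\<close> with range \<open>a\<close>.\<close>

record ('v, 'e) ordered_bratteli = "('v, 'e) bratteli" +
  edge_ord :: "nat \<Rightarrow> 'v \<Rightarrow> ('e \<times> 'e) set"

definition edges_into :: "('v, 'e, 'z) bratteli_scheme \<Rightarrow> nat \<Rightarrow> 'v \<Rightarrow> 'e set" where
  "edges_into B n a = {e \<in> edges B n. rng B n e = a}"

definition ordered_diagram :: "('v, 'e) ordered_bratteli \<Rightarrow> bool" where
  "ordered_diagram B \<longleftrightarrow>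
     bratteli_diagram B \<and>
     (\<forall>n\<ge>1. \<forall>a\<in>verts B n. linear_order_on (edges_into B n a) (edge_ord B n a))"

definition max_edge :: "('v, 'e) ordered_bratteli \<Rightarrow> nat \<Rightarrow> 'e \<Rightarrow> bool" where
  "max_edge B n e \<longleftrightarrow>
     e \<in> edges B n \<and> (\<forall>f\<in>edges_into B n (rng B n e). (f, e) \<in> edge_ord B n (rng B n e))"

definition min_edge :: "('v, 'e) ordered_bratteli \<Rightarrow> nat \<Rightarrow> 'e \<Rightarrow> bool" where
  "min_edge B n e \<longleftrightarrow>
     e \<in> edges B n \<and> (\<forall>f\<in>edges_into B n (rng B n e). (e, f) \<in> edge_ord B n (rng B n e))"

definition maximal_path :: "('v, 'e) ordered_bratteli \<Rightarrow> (nat \<Rightarrow> 'e) \<Rightarrow> bool" where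
  "maximal_path B x \<longleftrightarrow> x \<in> path_space B \<and> (\<forall>n\<ge>1. max_edge B n (x n))"

definition minimal_path :: "('v, 'e) ordered_bratteli \<Rightarrow> (nat \<Rightarrow> 'e) \<Rightarrow> bool" where
  "minimal_path B x \<longleftrightarrow> x \<in> path_space B \<and> (\<forall>n\<ge>1. min_edge B n (x n))"

definition semi_proper :: "('v, 'e) ordered_bratteli \<Rightarrow> bool" where
  "semi_proper B \<longleftrightarrow> ordered_diagram B \<and> simple_diagram B \<and> (\<exists>!x. minimal_path B x)"

definition succ_edge :: "('v, 'e) ordered_bratteli \<Rightarrow> nat \<Rightarrow> 'e \<Rightarrow> 'e" where
  "succ_edge B n e =
     (let a = rng B n e in
       THE f. f \<in> edges_into B n a \<and> f \<noteq> e \<and> (e, f) \<in> edge_ord B n a \<and>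
              (\<forall>g\<in>edges_into B n a. g \<noteq> e \<and> (e, g) \<in> edge_ord B n a \<longrightarrow> (f, g) \<in> edge_ord B n a))"

text \<open>The Vershik map of a semi-proper diagram, including its extension to the maximal paths.  In the
  second case there is exactly one such path \<open>z\<close>, because the edges below level \<open>k\<close> are determined
  downwards from the source of the \<open>k\<close>-th one.\<close>

definition vershik :: "('v, 'e) ordered_bratteli \<Rightarrow> (nat \<Rightarrow> 'e) \<Rightarrow> nat \<Rightarrow> 'e" where
  "vershik B x =
     (if maximal_path B x then (THE z. minimal_path B z)
      else
        (let k = (LEAST k. k \<ge> 1 \<and> \<not> max_edge B k (x k)) in
          THE z. z \<in> path_space B \<and> (\<forall>n>k. z n = x n) \<and> z k = succ_edge B k (x k) \<and>
                 (\<forall>n. 1 \<le> n \<and> n < k \<longrightarrow> min_edge B n (z n))))"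

text \<open>Stationarity: after identifying the levels with a common vertex set \<open>W\<close>, all levels of edges
  from level 2 on are copies of one ordered edge set \<open>F\<close> with source \<open>S\<close>, range \<open>R\<close> and fibrewise
  order \<open>Q\<close>.\<close>

definition stationary :: "('v, 'e) ordered_bratteli \<Rightarrow> bool" where
  "stationary B \<longleftrightarrow>
     (\<exists>(W :: 'v set) (F :: 'e set) (S :: 'e \<Rightarrow> 'v) (R :: 'e \<Rightarrow> 'v) (Q :: 'v \<Rightarrow> ('e \<times> 'e) set)
        (\<phi> :: nat \<Rightarrow> 'v \<Rightarrow> 'v) (\<psi> :: nat \<Rightarrow> 'e \<Rightarrow> 'e).
        (\<forall>n\<ge>1. bij_betw (\<phi> n) (verts B n) W) \<and>
        (\<forall>n\<ge>2. bij_betw (\<psi> n) (edges B n) F \<and>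
           (\<forall>e\<in>edges B n. S (\<psi> n e) = \<phi> (n - 1) (src B n e) \<and> R (\<psi> n e) = \<phi> n (rng B n e)) \<and>
           (\<forall>a\<in>verts B n. \<forall>e\<in>edges_into B n a. \<forall>f\<in>edges_into B n a.
              (e, f) \<in> edge_ord B n a \<longleftrightarrow> (\<psi> n e, \<psi> n f) \<in> Q (\<phi> n a))))"

end

(* Let y be the branch point.  The images of its M preimages under tau are again distinct points that
   merge, and they can only merge at y; so y = s tau(y) for the longest common suffix s of the words
   tau(b), where b y runs over the preimages.  On a cylinder C around y that is so small that every
   left letter of a point of C is one of these b, the map theta c = s tau(c) sends C into C, and the
   first return word r of c to C has constant return time |tau(r)| from theta c to theta(C).  Hence X
   is partitioned both into the towers over C and into those over theta(C): two points whose orbits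
   merge do so at y, which lies in the base.  Iterating theta gives nested partitions whose transition
   rule does not depend on the level, that is, a stationary diagram whose vertices are return words.
   The intersection of the sets theta^k(C) is {y}, the unique minimal path. *)
theory Submission
  imports Defs
begin

section \<open>Sequences and words\<close>

text \<open>The obstacle is that \<open>shift\<close> is not injective on \<open>X\<close>, so
  orbits cannot be followed backwards. Plain \<open>T\<close> is also unsuitable for
  renormalization: it need not fix \<open>y\<close> or map \<open>C\<close> into \<open>C\<close>,
  and the prefix \<open>s\<close> repairs both. That \<theta>(C) is reached after
  \<open>length (W r)\<close> steps comes from the left letters, because an image
  \<open>\<tau> b\<close> ends in \<open>s\<close>, so the block \<open>s\<close> in front of
  \<open>T c\<close> reappears at the next visit. That it is not reached earlier comes from
  recognizability. Instead of a sequence of partitions the proof iterates one map \<open>D\<close>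
  on \<open>C\<close>, a left inverse of \<theta>: it sends \<open>c\<close> to the point
  \<open>d\<close> such that \<open>c\<close> lies in the tower over \<open>\<theta> d\<close>. The
  path of \<open>x\<close> lists labels and heights along \<open>D ^^ k\<close> of the base point of
  \<open>x\<close>, and the shift acts on these data like an odometer with carries. The length
  \<open>n\<close> of the cylinder serves two purposes: it controls left letters, and it makes the
  prefix of \<open>y\<close> contain \<open>u 0\<close>, the letter whose iterated images are known
  to grow. This growth shrinks \<theta>^k(C) to \<open>y\<close>.\<close>

definition sh :: "nat \<Rightarrow> (nat \<Rightarrow> 'a) \<Rightarrow> nat \<Rightarrow> 'a" where
  "sh k x = (\<lambda>i. x (i + k))"

definition app :: "'a list \<Rightarrow> (nat \<Rightarrow> 'a) \<Rightarrow> nat \<Rightarrow> 'a"  (infixr "@-" 65) where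
  "v @- x = (\<lambda>i. if i < length v then v ! i else x (i - length v))"

definition agree :: "nat \<Rightarrow> (nat \<Rightarrow> 'a) \<Rightarrow> (nat \<Rightarrow> 'a) \<Rightarrow> bool" where
  "agree m x x' \<longleftrightarrow> (\<forall>i<m. x i = x' i)"

lemma funpow_shift: "(shift ^^ k) x = sh k x"
  by (induction k) (auto simp: sh_def shift_def fun_eq_iff)

lemma shift_eq_sh: "shift x = sh 1 x"
  by (auto simp: sh_def shift_def fun_eq_iff)

lemma sh_0 [simp]: "sh 0 x = x"
  by (simp add: sh_def)

lemma sh_sh: "sh a (sh b x) = sh (a + b) x"
  by (simp add: sh_def algebra_simps)

lemma app_Nil [simp]: "[] @- x = x"
  by (simp add: app_def)

lemma app_append: "(v @ w) @- x = v @- (w @- x)"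
  by (auto simp: app_def fun_eq_iff nth_append)

lemma sh_app [simp]: "sh (length v) (v @- x) = x"
  by (simp add: sh_def app_def)

lemma sh_app_le: "k \<le> length v \<Longrightarrow> sh k (v @- x) = drop k v @- x"
  by (auto simp: sh_def app_def fun_eq_iff add.commute intro!: arg_cong[where f = x])

lemma sh_app_ge: "length v \<le> k \<Longrightarrow> sh k (v @- x) = sh (k - length v) x"
  by (auto simp: sh_def app_def fun_eq_iff)

lemma length_factor [simp]: "length (factor x i l) = l"
  by (simp add: factor_def)

lemma nth_factor [simp]: "j < l \<Longrightarrow> factor x i l ! j = x (i + j)"
  by (simp add: factor_def)

lemma factor_sh: "factor (sh k x) i l = factor x (i + k) l"
  by (rule nth_equalityI) (auto simp: sh_def algebra_simps)

lemma factor_0 [simp]: "factor x i 0 = []"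
  by (simp add: factor_def)

lemma factor_add: "factor x i (a + b) = factor x i a @ factor x (i + a) b"
  by (rule nth_equalityI) (auto simp: nth_append)

lemma app_factor: "factor x 0 k @- sh k x = x"
  by (auto simp: app_def sh_def fun_eq_iff)

lemma factor_app [simp]: "factor (v @- x) 0 (length v) = v"
  by (rule nth_equalityI) (auto simp: app_def)

lemma factor_app_le: "k \<le> length v \<Longrightarrow> factor (v @- x) 0 k = take k v"
  by (rule nth_equalityI) (auto simp: app_def)

lemma factor_app_add: "factor (v @- x) 0 (length v + k) = v @ factor x 0 k"
  by (rule nth_equalityI) (auto simp: app_def nth_append)

lemma app_inject: "length v = length v' \<Longrightarrow> v @- x = v' @- x' \<longleftrightarrow> v = v' \<and> x = x'"
  by (metis factor_app sh_app)

lemma app_same [simp]: "v @- x = v @- x' \<longleftrightarrow> x = x'"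
  by (simp add: app_inject)

lemma take_factor: "k \<le> l \<Longrightarrow> take k (factor x i l) = factor x i k"
  by (rule nth_equalityI) auto

lemma agree_factor: "agree m x x' \<longleftrightarrow> factor x 0 m = factor x' 0 m"
  by (auto simp: agree_def list_eq_iff_nth_eq)

lemma agree_mono: "agree m x x' \<Longrightarrow> k \<le> m \<Longrightarrow> agree k x x'"
  by (auto simp: agree_def)

lemma agree_sym: "agree m x x' \<Longrightarrow> agree m x' x"
  by (auto simp: agree_def)

lemma agree_trans: "agree m x x' \<Longrightarrow> agree m x' x'' \<Longrightarrow> agree m x x''"
  by (auto simp: agree_def)

lemma agree_refl [simp]: "agree m x x"
  by (auto simp: agree_def)

lemma agree_sh: "agree (k + m) x x' \<Longrightarrow> agree m (sh k x) (sh k x')"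
  by (auto simp: agree_def sh_def)

lemma agree_app: "agree (length v + m) (v @- x) (v @- x') \<longleftrightarrow> agree m x x'"
  by (auto simp: agree_factor factor_app_add)

lemma eq_if_agree_all: "(\<And>m. agree m x x') \<Longrightarrow> x = x'"
  by (meson agree_def ext lessI)

lemma factors_factor: "factor x i l \<in> factors x"
  by (auto simp: factors_def)

lemma factor_of_factor: "a + b \<le> l \<Longrightarrow> factor x (i + a) b = take b (drop a (factor x i l))"
  by (rule nth_equalityI) (auto simp: add.assoc)

lemma factors_sublist:
  assumes "v @ w @ v' \<in> factors x" shows "w \<in> factors x"
proof -
  obtain i l where il: "v @ w @ v' = factor x i l"
    using assms by (auto simp: factors_def)
  then have len: "l = length v + (length w + length v')" by (metis length_append length_factor)
  have "factor x (i + length v) (length w) = take (length w) (drop (length v) (v @ w @ v'))"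
    using factor_of_factor[of "length v" "length w" l x i] il len by simp
  then show ?thesis by (metis append_eq_conv_conj factors_factor)
qed

subsection \<open>The topology of pointwise convergence\<close>

abbreviation seq_topology :: "(nat \<Rightarrow> 'a) topology" where
  "seq_topology \<equiv> product_topology (\<lambda>_. discrete_topology UNIV) UNIV"

text \<open>A basic open set restricts finitely many coordinates, hence only an initial segment.
  This reduces later topological questions about sequences to \<open>agree\<close>.\<close>

lemma openin_seq_topology:
  "openin seq_topology U \<longleftrightarrow> (\<forall>x\<in>U. \<exists>m. \<forall>x'. agree m x x' \<longrightarrow> x' \<in> U)"
proof
  assume o: "openin seq_topology U"
  show "\<forall>x\<in>U. \<exists>m. \<forall>x'. agree m x x' \<longrightarrow> x' \<in> U"
  proof
    fix x assume "x \<in> U"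
    then obtain V where fin: "finite {i. V i \<noteq> UNIV}" and x: "x \<in> Pi\<^sub>E UNIV V" and V: "Pi\<^sub>E UNIV V \<subseteq> U"
      using o unfolding openin_product_topology_alt by auto
    obtain m where m: "\<And>i. V i \<noteq> UNIV \<Longrightarrow> i < m"
      using finite_nat_bounded[OF fin] by auto
    have "x' \<in> U" if "agree m x x'" for x'
    proof -
      have "x' i \<in> V i" for i
        using x m[of i] that by (cases "V i = UNIV") (auto simp: agree_def PiE_iff dest: spec[of _ i])
      then show ?thesis using V by auto
    qed
    then show "\<exists>m. \<forall>x'. agree m x x' \<longrightarrow> x' \<in> U" by blast
  qed
next
  assume *: "\<forall>x\<in>U. \<exists>m. \<forall>x'. agree m x x' \<longrightarrow> x' \<in> U"
  show "openin seq_topology U"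
    unfolding openin_product_topology_alt
  proof
    fix x assume "x \<in> U"
    then obtain m where m: "\<And>x'. agree m x x' \<Longrightarrow> x' \<in> U" using * by blast
    define V where "V = (\<lambda>i. if i < m then {x i} else UNIV)"
    have "{i. V i \<noteq> UNIV} \<subseteq> {..<m}" by (auto simp: V_def)
    then have "finite {i. V i \<noteq> UNIV}" by (rule finite_subset) simp
    moreover have "Pi\<^sub>E UNIV V \<subseteq> U"
    proof
      fix x' assume "x' \<in> Pi\<^sub>E UNIV V"
      then have "\<And>i. x' i \<in> V i" by auto
      then have "agree m x x'" by (auto simp: agree_def V_def split: if_splits) (metis singletonD)
      then show "x' \<in> U" by (rule m)
    qed
    ultimately show "\<exists>V. finite {i \<in> UNIV. V i \<noteq> topspace (discrete_topology UNIV)} \<and>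
        (\<forall>i\<in>UNIV. openin (discrete_topology UNIV) (V i)) \<and> x \<in> Pi\<^sub>E UNIV V \<and> Pi\<^sub>E UNIV V \<subseteq> U"
      by (intro exI[of _ V]) (auto simp: V_def)
  qed
qed

lemma openin_subseq_topology:
  "openin (subtopology seq_topology S) U \<longleftrightarrow>
     U \<subseteq> S \<and> (\<forall>x\<in>U. \<exists>m. \<forall>x'\<in>S. agree m x x' \<longrightarrow> x' \<in> U)" (is "?L \<longleftrightarrow> ?R")
proof
  assume ?L
  then obtain V where V: "openin seq_topology V" "U = V \<inter> S"
    by (auto simp: openin_subtopology)
  then show ?R unfolding openin_seq_topology by (metis IntD1 IntI Int_lower2)
next
  assume R: ?R
  define V where "V = {x'. \<exists>x\<in>U. \<exists>m. agree m x x' \<and> (\<forall>x''\<in>S. agree m x x'' \<longrightarrow> x'' \<in> U)}"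
  have "openin seq_topology V"
    unfolding openin_seq_topology V_def using agree_trans by blast
  moreover have "x \<in> V" if "x \<in> U" for x
    unfolding V_def using R that agree_refl[of _ x] by blast
  then have "U = V \<inter> S" using R by (auto simp: V_def)
  ultimately show ?L by (auto simp: openin_subtopology)
qed

lemma closedin_subseq_topology:
  "closedin (subtopology seq_topology S) Z \<longleftrightarrow>
     Z \<subseteq> S \<and> (\<forall>x\<in>S - Z. \<exists>m. \<forall>x'\<in>S. agree m x x' \<longrightarrow> x' \<notin> Z)"
  by (auto simp: closedin_def openin_subseq_topology)

lemma Hausdorff_seq_topology: "Hausdorff_space seq_topology"
  by (simp add: Hausdorff_space_product_topology)

lemma compact_seq_topology: "compact_space (seq_topology :: (nat \<Rightarrow> 'a::finite) topology)"
  by (simp add: compact_space_product_topology compact_space_discrete_topology)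

lemma continuous_map_seqI:
  assumes "f ` S \<subseteq> S'"
    and "\<And>i. \<exists>m. \<forall>x\<in>S. \<forall>x'\<in>S. agree m x x' \<longrightarrow> agree i (f x) (f x')"
  shows "continuous_map (subtopology seq_topology S) (subtopology seq_topology S') f"
  unfolding continuous_map_def
proof (intro conjI allI impI)
  show "f \<in> topspace (subtopology seq_topology S) \<rightarrow> topspace (subtopology seq_topology S')"
    using assms(1) by auto
  fix U assume U: "openin (subtopology seq_topology S') U"
  have "\<exists>m. \<forall>x'\<in>S. agree m x x' \<longrightarrow> f x' \<in> U" if x: "x \<in> S" "f x \<in> U" for x
  proof -
    obtain i where i: "\<And>z. z \<in> S' \<Longrightarrow> agree i (f x) z \<Longrightarrow> z \<in> U"
      using U x unfolding openin_subseq_topology by blast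
    obtain m where "\<forall>x\<in>S. \<forall>x'\<in>S. agree m x x' \<longrightarrow> agree i (f x) (f x')" using assms(2) by blast
    then show ?thesis using i x assms(1) by blast
  qed
  then show "openin (subtopology seq_topology S) {x \<in> topspace (subtopology seq_topology S). f x \<in> U}"
    by (auto simp: openin_subseq_topology)
qed

section \<open>Substitutions\<close>

lemma subst_word_append [simp]: "subst_word \<tau> (v @ w) = subst_word \<tau> v @ subst_word \<tau> w"
  by (simp add: subst_word_def)

lemma subst_word_Nil [simp]: "subst_word \<tau> [] = []"
  by (simp add: subst_word_def)

lemma subst_word_single [simp]: "subst_word \<tau> [a] = \<tau> a"
  by (simp add: subst_word_def)

lemma funpow_subst_word_append:
  "(subst_word \<tau> ^^ n) (v @ w) = (subst_word \<tau> ^^ n) v @ (subst_word \<tau> ^^ n) w"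
  by (induction n) auto

lemma length_subst_word:
  assumes "substitution \<tau>" shows "length v \<le> length (subst_word \<tau> v)"
proof (induction v)
  case (Cons a v)
  have "length (\<tau> a) \<ge> 1" using assms by (simp add: substitution_def Suc_le_eq)
  with Cons show ?case by (simp add: subst_word_def)
qed simp

text \<open>Of two prefixes of \<open>x\<close> one extends the other, and so do their images; hence
  every prefix with a long enough image shows the same letter as the one in the definition of
  \<open>subst_seq\<close>.\<close>

lemma subst_seq_nth:
  assumes \<tau>: "substitution \<tau>" and m: "m < length (subst_word \<tau> (factor x 0 p))"
  shows "subst_seq \<tau> x m = subst_word \<tau> (factor x 0 p) ! m"
proof -
  have m': "m < length (subst_word \<tau> (factor x 0 (Suc m)))"
    using length_subst_word[OF \<tau>, of "factor x 0 (Suc m)"] by simp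
  show ?thesis
  proof (cases "p \<le> Suc m")
    case True
    then have "factor x 0 (Suc m) = factor x 0 p @ factor x p (Suc m - p)"
      using factor_add[of x 0 p "Suc m - p"] by simp
    then show ?thesis using m by (simp add: subst_seq_def nth_append)
  next
    case False
    then have "factor x 0 p = factor x 0 (Suc m) @ factor x (Suc m) (p - Suc m)"
      using factor_add[of x 0 "Suc m" "p - Suc m"] by simp
    then show ?thesis using m' by (simp add: subst_seq_def nth_append)
  qed
qed

lemma subst_seq_app:
  assumes \<tau>: "substitution \<tau>"
  shows "subst_seq \<tau> (v @- x) = subst_word \<tau> v @- subst_seq \<tau> x"
proof
  fix m
  show "subst_seq \<tau> (v @- x) m = (subst_word \<tau> v @- subst_seq \<tau> x) m"
  proof (cases "m < length (subst_word \<tau> v)")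
    case True
    then show ?thesis using subst_seq_nth[OF \<tau>, of m "v @- x" "length v"] by (simp add: app_def[of "subst_word \<tau> v"])
  next
    case False
    define k where "k = m - length (subst_word \<tau> v)"
    have k: "k < length (subst_word \<tau> (factor x 0 (Suc k)))"
      using length_subst_word[OF \<tau>, of "factor x 0 (Suc k)"] by simp
    have "subst_seq \<tau> (v @- x) m = (subst_word \<tau> v @ subst_word \<tau> (factor x 0 (Suc k))) ! m"
      using subst_seq_nth[OF \<tau>, of m "v @- x" "length v + Suc k"] k False
      by (simp only: factor_app_add subst_word_append) (simp add: k_def)
    also have "\<dots> = subst_seq \<tau> x k"
      using False k subst_seq_nth[OF \<tau> k] by (simp add: nth_append k_def)
    finally show ?thesis using False by (simp add: app_def k_def)
  qed
qed

lemma subst_seq_split: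
  assumes "substitution \<tau>"
  shows "subst_seq \<tau> x = subst_word \<tau> (factor x 0 p) @- subst_seq \<tau> (sh p x)"
  by (metis app_factor assms subst_seq_app)

lemma agree_subst_seq:
  assumes "substitution \<tau>" "agree m x x'"
  shows "agree (length (subst_word \<tau> (factor x 0 m))) (subst_seq \<tau> x) (subst_seq \<tau> x')"
  using subst_seq_split[OF assms(1), of x m] subst_seq_split[OF assms(1), of x' m] assms(2)
  by (metis agree_factor factor_app)

lemma length_subst_factor_mono:
  "p \<le> q \<Longrightarrow> length (subst_word \<tau> (factor x i p)) \<le> length (subst_word \<tau> (factor x i q))"
  using factor_add[of x i p "q - p"] by simp

lemma length_subst_factor_strict_mono:
  assumes "substitution \<tau>" "p < q"
  shows "length (subst_word \<tau> (factor x i p)) < length (subst_word \<tau> (factor x i q))"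
proof -
  have "length (factor x (i + p) (q - p)) > 0" using assms(2) by simp
  then have "0 < length (subst_word \<tau> (factor x (i + p) (q - p)))"
    using length_subst_word[OF assms(1)] by (rule less_le_trans)
  then show ?thesis using factor_add[of x i p "q - p"] assms(2) by simp
qed

lemma factors_app: "v \<in> factors x \<longleftrightarrow> (\<exists>p z. x = p @- v @- z)"
proof
  assume "v \<in> factors x"
  then obtain i l where v: "v = factor x i l" by (auto simp: factors_def)
  have "x = factor x 0 i @- v @- sh l (sh i x)"
    using app_factor[of "sh i x" l] app_factor[of x i] by (simp add: v factor_sh)
  then show "\<exists>p z. x = p @- v @- z" by blast
next
  assume "\<exists>p z. x = p @- v @- z"
  then obtain p z where x: "x = p @- v @- z" by blast
  have "factor x (length p) (length v) = v"
    using factor_sh[of "length p" x 0 "length v"] by (simp add: x)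
  then show "v \<in> factors x" by (metis factors_factor)
qed

lemma factor_shorter:
  assumes "factor x 0 m \<in> factors z" "k \<le> m" shows "factor x 0 k \<in> factors z"
  using factors_sublist[of "[]" "factor x 0 k" "factor x k (m - k)" z] factor_add[of x 0 k "m - k"] assms
  by simp

lemma cons_app: "[x 0] @- sh 1 x = x"
  using app_factor[of x 1] by (simp add: factor_def)

section \<open>Compactness, minimality and merging orbits in the subshift\<close>

locale branching_substitution =
  fixes \<tau> :: "'a::finite \<Rightarrow> 'a list" and u y :: "nat \<Rightarrow> 'a"
  assumes substitution: "substitution \<tau>"
    and recognizable: "recognizable \<tau> u"
    and fixed_point: "generating_fixed_point \<tau> u"
    and minimal: "minimal_system (subshift_topology \<tau>) shift"
    and inj: "inj \<tau>"
    and branch_y: "branch_point (subshift_topology \<tau>) shift y"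
    and branch_unique: "\<And>z. branch_point (subshift_topology \<tau>) shift z \<Longrightarrow> z = y"
begin

abbreviation "X \<equiv> subshift \<tau>"
abbreviation "XT \<equiv> subshift_topology \<tau>"
abbreviation "W \<equiv> subst_word \<tau>"
abbreviation "T \<equiv> subst_seq \<tau>"

lemma T_app: "T (v @- x) = W v @- T x"
  by (rule subst_seq_app[OF substitution])

lemma T_u: "T u = u" and lang_eq: "lang \<tau> = factors u"
  using fixed_point by (auto simp: generating_fixed_point_def)

lemma \<tau>_nonempty: "\<tau> b \<noteq> []"
  using substitution by (simp add: substitution_def)

lemma mem_X: "x \<in> X \<longleftrightarrow> (\<forall>m. factor x 0 m \<in> factors u)"
proof
  assume "x \<in> X"
  then show "\<forall>m. factor x 0 m \<in> factors u"
    by (auto simp: subshift_def lang_eq factors_factor subset_iff)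
next
  assume *: "\<forall>m. factor x 0 m \<in> factors u"
  have "factor x i l \<in> factors u" for i l
    using factors_sublist[of "factor x 0 i" "factor x i l" "[]" u] spec[OF *, of "i + l"]
    by (simp add: factor_add)
  then show "x \<in> X" by (auto simp: subshift_def lang_eq factors_def[of x])
qed

lemma u_in_X: "u \<in> X"
  by (simp add: mem_X factors_factor)

lemma sh_in_X: "x \<in> X \<Longrightarrow> sh k x \<in> X"
  unfolding subshift_def by (auto simp: factors_def[of "sh k x"] factor_sh factors_factor subset_iff)

lemma W_factors: "v \<in> factors u \<Longrightarrow> W v \<in> factors u"
  unfolding factors_app by (metis T_u T_app)

lemma T_in_X:
  assumes "x \<in> X" shows "T x \<in> X"
  unfolding mem_X
proof
  fix m
  have "T x = W (factor x 0 m) @- T (sh m x)" by (rule subst_seq_split[OF substitution])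
  then have "factor (T x) 0 (length (W (factor x 0 m))) \<in> factors u"
    using W_factors assms by (metis factor_app mem_X)
  moreover have "m \<le> length (W (factor x 0 m))"
    using length_subst_word[OF substitution, of "factor x 0 m"] by simp
  ultimately show "factor (T x) 0 m \<in> factors u" by (rule factor_shorter)
qed

lemma topspace_XT [simp]: "topspace XT = X"
  by (simp add: subshift_topology_def)

lemma openin_XT: "openin XT U \<longleftrightarrow> U \<subseteq> X \<and> (\<forall>x\<in>U. \<exists>m. \<forall>x'\<in>X. agree m x x' \<longrightarrow> x' \<in> U)"
  unfolding subshift_topology_def by (rule openin_subseq_topology)

lemma closedin_XT: "closedin XT Z \<longleftrightarrow> Z \<subseteq> X \<and> (\<forall>x\<in>X - Z. \<exists>m. \<forall>x'\<in>X. agree m x x' \<longrightarrow> x' \<notin> Z)"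
  unfolding subshift_topology_def by (rule closedin_subseq_topology)

lemma closedin_X: "closedin seq_topology X"
proof -
  have "\<exists>m. \<forall>x'. agree m x x' \<longrightarrow> x' \<notin> X" if "x \<notin> X" for x
    using that unfolding mem_X agree_factor by metis
  then show ?thesis by (auto simp: closedin_def openin_seq_topology)
qed

lemma compact_XT: "compact_space XT"
  unfolding subshift_topology_def
  by (intro compact_space_subtopology closedin_compact_space compact_seq_topology closedin_X)

lemma Hausdorff_XT: "Hausdorff_space XT"
  unfolding subshift_topology_def by (intro Hausdorff_space_subtopology Hausdorff_seq_topology)

text \<open>The image of a compact set is compact, hence closed in a Hausdorff space. Continuity is
  asked only on \<open>S\<close>, since the maps below are controlled on \<open>C\<close>
  only.\<close>

lemma closedin_image:
  assumes Z: "closedin XT Z" "Z \<subseteq> S" and f: "\<And>x. x \<in> S \<Longrightarrow> f x \<in> X"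
    and cont: "\<And>i. \<exists>m. \<forall>x\<in>S. \<forall>x'\<in>S. agree m x x' \<longrightarrow> agree i (f x) (f x')"
  shows "closedin XT (f ` Z)"
proof -
  have "compactin XT Z" using Z(1) compact_XT by (rule closedin_compact_space[rotated])
  then have "compactin (subtopology seq_topology S) Z"
    using Z(2) by (auto simp: subshift_topology_def compactin_subtopology)
  moreover have "continuous_map (subtopology seq_topology S) XT f"
    unfolding subshift_topology_def using f cont by (intro continuous_map_seqI) auto
  ultimately have "compactin XT (f ` Z)" by (rule image_compactin)
  then show ?thesis using Hausdorff_XT by (rule compactin_imp_closedin[rotated])
qed

lemma closure_orbit:
  assumes "x \<in> X" shows "XT closure_of (range (\<lambda>n. sh n x)) = X"
  using minimal assms unfolding minimal_system_def topspace_XT funpow_shift by blast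

lemma visits:
  assumes "x \<in> X" "z \<in> X" shows "\<exists>n. agree m (sh n x) z"
proof -
  have "z \<in> XT closure_of (range (\<lambda>n. sh n x))" using assms closure_orbit by simp
  moreover have "openin XT {x'\<in>X. agree m z x'}"
    unfolding openin_XT using agree_trans by blast
  moreover have "z \<in> {x'\<in>X. agree m z x'}" using assms(2) by simp
  ultimately obtain z' where "z' \<in> range (\<lambda>n. sh n x)" "z' \<in> {x'\<in>X. agree m z x'}"
    unfolding in_closure_of by meson
  then show ?thesis using agree_sym by blast
qed

text \<open>Serves as an induction principle: a closed property that holds at one point and is
  preserved by the shift holds on all of \<open>X\<close>.\<close>

lemma minimal_closed:
  assumes "closedin XT Z" "x \<in> Z" "\<And>x. x \<in> Z \<Longrightarrow> sh 1 x \<in> Z" shows "Z = X"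
proof -
  have "Z \<subseteq> X" using assms(1) closedin_subset by force
  have "sh n x \<in> Z" for n
  proof (induction n)
    case (Suc n)
    then show ?case using assms(3)[of "sh n x"] by (simp add: sh_sh)
  qed (use assms in simp)
  then have "XT closure_of (range (\<lambda>n. sh n x)) \<subseteq> Z"
    using assms(1) by (intro closure_of_minimal) auto
  then show ?thesis using closure_orbit[of x] \<open>Z \<subseteq> X\<close> assms(2) by blast
qed

text \<open>By minimality the open sets \<open>U t\<close> cover \<open>X\<close>, and by
  compactness finitely many of them do.\<close>

lemma bounded_visits:
  assumes "z \<in> X" shows "\<exists>B. \<forall>x\<in>X. \<exists>t<B. agree m (sh t x) z"
proof -
  define U where "U = (\<lambda>t. {x \<in> X. agree m (sh t x) z})"
  have "openin XT (U t)" for t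
  proof -
    have "agree m (sh t x') z" if "agree (t + m) x x'" "agree m (sh t x) z" for x x'
      using that agree_sh agree_trans agree_sym by blast
    then show ?thesis unfolding openin_XT U_def by blast
  qed
  moreover have "X \<subseteq> \<Union> (range U)"
    using visits[OF _ assms] by (auto simp: U_def)
  ultimately obtain F where F: "finite F" "F \<subseteq> range U" "X \<subseteq> \<Union> F"
    using compact_XT unfolding compact_space_alt topspace_XT by (metis imageE)
  obtain A where A: "finite A" "F = U ` A" using F finite_subset_image by metis
  obtain B where "\<And>t. t \<in> A \<Longrightarrow> t < B" using finite_nat_bounded[OF A(1)] by auto
  moreover have "\<exists>t\<in>A. x \<in> U t" if "x \<in> X" for x using that F(3) A(2) by auto
  ultimately have "\<exists>t<B. agree m (sh t x) z" if "x \<in> X" for x using that unfolding U_def by blast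
  then show ?thesis by blast
qed

text \<open>Each letter that does not extend \<open>x\<close> is excluded by some finite prefix; the
  alphabet is finite, so one length works for all letters.\<close>

lemma no_left_extension:
  "\<exists>n. \<forall>b. [b] @- x \<notin> X \<longrightarrow> b # factor x 0 n \<notin> factors u"
proof -
  have "\<forall>b. \<exists>m. [b] @- x \<notin> X \<longrightarrow> factor ([b] @- x) 0 m \<notin> factors u"
    using mem_X by blast
  from choice[OF this] obtain m where
    m: "\<And>b. [b] @- x \<notin> X \<Longrightarrow> factor ([b] @- x) 0 (m b) \<notin> factors u" by blast
  define n where "n = Max (range m)"
  have "b # factor x 0 n \<notin> factors u" if "[b] @- x \<notin> X" for b
  proof
    assume "b # factor x 0 n \<in> factors u"
    then have "factor ([b] @- x) 0 (1 + n) \<in> factors u" using factor_app_add[of "[b]" x n] by simp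
    moreover have "m b \<le> 1 + n" by (simp add: n_def le_SucI)
    ultimately show False using m[OF that] factor_shorter by blast
  qed
  then show ?thesis by (intro exI[of _ n]) simp
qed

lemma left_extension:
  assumes "x \<in> X" shows "\<exists>b. [b] @- x \<in> X"
proof -
  obtain n where n: "\<And>b. [b] @- x \<notin> X \<Longrightarrow> b # factor x 0 n \<notin> factors u"
    using no_left_extension[of x] by blast
  \<comment> \<open>Starting from \<open>sh 1 u\<close> ensures that a letter precedes the
    occurrence found in \<open>u\<close>.\<close>
  obtain k where "agree n (sh k (sh 1 u)) x"
    using visits[OF sh_in_X[OF u_in_X] assms] by blast
  then have "factor u (k + 1) n = factor x 0 n" by (simp add: agree_factor sh_sh factor_sh)
  then have "factor u k (1 + n) = u k # factor x 0 n" by (subst factor_add) (simp add: factor_def)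
  then show ?thesis using n by (metis factors_factor)
qed

lemma y_in_X: "y \<in> X"
  using branch_y by (simp add: branch_point_def)

lemma branchD:
  assumes "z \<in> X" "z' \<in> X" "sh 1 z = sh 1 z'" "z \<noteq> z'" shows "sh 1 z = y"
proof (rule branch_unique)
  have "z \<in> preimages XT shift (sh 1 z)" "z' \<in> preimages XT shift (sh 1 z)"
    using assms(1-3) by (simp_all add: preimages_def shift_eq_sh del: One_nat_def)
  then show "branch_point XT shift (sh 1 z)"
    unfolding branch_point_def topspace_XT using assms(4) sh_in_X[OF assms(1)] by blast
qed

lemma y_preimages: "\<exists>b b'. b \<noteq> b' \<and> [b] @- y \<in> X \<and> [b'] @- y \<in> X"
proof -
  obtain z z' where "z \<in> X" "z' \<in> X" "sh 1 z = y" "sh 1 z' = y" "z \<noteq> z'"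
    using branch_y unfolding branch_point_def preimages_def shift_eq_sh topspace_XT by blast
  moreover from this have "[z 0] @- y = z" "[z' 0] @- y = z'"
    using cons_app[of z] cons_app[of z'] by simp_all
  ultimately show ?thesis by metis
qed

text \<open>Just before the two orbits coincide they sit at distinct preimages of one point, and
  that point can only be \<open>y\<close>.\<close>

lemma branch_between:
  assumes "x \<in> X" "x' \<in> X" "sh t x = sh t x'" "x \<noteq> x'"
  shows "\<exists>i. 0 < i \<and> i \<le> t \<and> sh i x = y"
  using assms(3)
proof (induction t)
  case 0
  then show ?case using assms(4) by simp
next
  case (Suc t)
  show ?case
  proof (cases "sh t x = sh t x'")
    case True
    then show ?thesis using Suc.IH le_SucI by blast
  next
    case False
    then have "sh 1 (sh t x) = y"
      using Suc.prems assms(1,2) by (intro branchD[of _ "sh t x'"]) (auto simp: sh_sh intro: sh_in_X)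
    then have "sh (Suc t) x = y" by (simp add: sh_sh)
    then show ?thesis by blast
  qed
qed

text \<open>The points of period \<open>p\<close> form a closed invariant set, so a single one would
  make all of \<open>X\<close> periodic. The shift would then be injective on \<open>X\<close>,
  contrary to the two preimages of \<open>y\<close>.\<close>

lemma not_periodic:
  assumes "p > 0" "x \<in> X" shows "sh p x \<noteq> x"
proof
  assume "sh p x = x"
  define Z where "Z = {z \<in> X. sh p z = z}"
  have "\<exists>m. \<forall>x'. agree m z x' \<longrightarrow> sh p x' \<noteq> x'" if "sh p z \<noteq> z" for z
  proof -
    have "\<exists>i. z (i + p) \<noteq> z i" using that by (auto simp: sh_def fun_eq_iff)
    then obtain i where i: "z (i + p) \<noteq> z i" by blast
    have "sh p x' \<noteq> x'" if x': "agree (i + p + 1) z x'" for x'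
    proof -
      have "z i = x' i" "z (i + p) = x' (i + p)" using x' by (auto simp: agree_def)
      then show ?thesis using i unfolding sh_def by metis
    qed
    then show ?thesis by blast
  qed
  then have "closedin XT Z" unfolding closedin_XT Z_def by blast
  moreover have "x \<in> Z" using assms \<open>sh p x = x\<close> by (simp add: Z_def)
  moreover have "sh 1 z \<in> Z" if "z \<in> Z" for z
  proof -
    have "sh p (sh 1 z) = sh 1 (sh p z)" by (simp only: sh_sh add.commute)
    then show ?thesis using that sh_in_X[of z 1] by (simp add: Z_def)
  qed
  ultimately have "Z = X" by (rule minimal_closed)
  obtain b b' where b: "b \<noteq> b'" "[b] @- y \<in> X" "[b'] @- y \<in> X" using y_preimages by blast
  have *: "[b] @- y = sh (p - 1) y" if "[b] @- y \<in> X" for b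
  proof -
    have "[b] @- y \<in> Z" using that \<open>Z = X\<close> by simp
    then have "sh p ([b] @- y) = [b] @- y" by (simp add: Z_def)
    moreover have "sh p ([b] @- y) = sh (p - 1) y" using \<open>p > 0\<close> sh_app_ge[of "[b]" p y] by simp
    ultimately show ?thesis by simp
  qed
  have "[b] @- y = [b'] @- y" using *[OF b(2)] *[OF b(3)] by simp
  then show False using b(1) by (simp add: app_inject)
qed

subsection \<open>Recognizability in the subshift\<close>

lemma cutting_points_iff: "j \<in> cutting_points \<tau> u \<longleftrightarrow> (\<exists>p. j = length (W (factor u 0 p)))"
proof
  assume "j \<in> cutting_points \<tau> u"
  then consider "j = length (W (factor u 0 0))" | p where "j = length (W (factor u 0 p))"
    by (auto simp: cutting_points_def)
  then show "\<exists>p. j = length (W (factor u 0 p))" by cases blast+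
next
  assume "\<exists>p. j = length (W (factor u 0 p))"
  then obtain p where "j = length (W (factor u 0 p))" by blast
  then show "j \<in> cutting_points \<tau> u" by (cases "p = 0") (auto simp: cutting_points_def)
qed

text \<open>Recognizability speaks about \<open>u\<close> only, so prefixes of \<open>x\<close> and
  \<open>x'\<close> are located in \<open>u\<close>. Their images start at cutting points of
  \<open>u\<close>, and \<open>eq\<close> makes the window of length \<open>L\<close> at offset
  \<open>k\<close> in the first image equal to the one at the start of the second; hence offset
  \<open>k\<close> is a cutting point as well.\<close>

lemma cut_at_factor:
  assumes "x \<in> X" "x' \<in> X" and eq: "sh k (T x) = T x'"
  shows "\<exists>p. k = length (W (factor x 0 p))"
proof -
  obtain L where L: "\<And>i j. factor u i L = factor u j L \<Longrightarrow> i \<in> cutting_points \<tau> u \<Longrightarrow> j \<in> cutting_points \<tau> u"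
    using recognizable unfolding recognizable_def by blast
  \<comment> \<open>\<open>W\<close> never shortens a word, so \<open>k + L\<close> letters of
    \<open>x\<close> determine the window of length \<open>L\<close> at position \<open>k\<close> of
    \<open>T x\<close>.\<close>
  define v where "v = factor x 0 (k + L)"
  obtain a z where az: "u = a @- v @- z" using assms(1) unfolding mem_X factors_app v_def by blast
  obtain a' z' where az': "u = a' @- factor x' 0 L @- z'" using assms(2) unfolding mem_X factors_app by blast
  have lenv: "k + L \<le> length (W v)" using length_subst_word[OF substitution, of v] by (simp add: v_def)
  have len': "L \<le> length (W (factor x' 0 L))"
    using length_subst_word[OF substitution, of "factor x' 0 L"] by simp
  have a: "a = factor u 0 (length a)" "a' = factor u 0 (length a')" using az az' by (metis factor_app)+
  have u1: "u = W a @- W v @- T z" using az T_u T_app by metis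
  have u2: "u = W a' @- W (factor x' 0 L) @- T z'" using az' T_u T_app by metis
  have Tx: "T x = W v @- T (sh (k + L) x)" unfolding v_def by (rule subst_seq_split[OF substitution])
  have Tx': "T x' = W (factor x' 0 L) @- T (sh L x')" by (rule subst_seq_split[OF substitution])
  have "factor u (length (W a) + k) L = factor (sh k (W v @- T z)) 0 L"
    using factor_sh[of "length (W a)" u k L] u1 factor_sh[of k "W v @- T z" 0 L]
    by (metis add.commute add_0 sh_app)
  also have "\<dots> = take L (drop k (W v))" using lenv by (simp add: sh_app_le factor_app_le)
  also have "\<dots> = factor (sh k (T x)) 0 L" using lenv by (simp add: Tx sh_app_le factor_app_le)
  also have "\<dots> = take L (W (factor x' 0 L))" using len' eq Tx' by (metis factor_app_le)
  also have "\<dots> = factor (sh (length (W a')) u) 0 L" using len' u2 by (metis factor_app_le sh_app)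
  finally have "factor u (length (W a')) L = factor u (length (W a) + k) L" by (simp add: factor_sh)
  moreover have "length (W a') \<in> cutting_points \<tau> u" using a(2) cutting_points_iff by metis
  ultimately obtain q where q: "length (W a) + k = length (W (factor u 0 q))"
    using L cutting_points_iff by metis
  \<comment> \<open>\<open>q\<close> counts letters from the start of \<open>u\<close>; the first
    \<open>length a\<close> of them precede the copy of \<open>v\<close> and are split off.\<close>
  have "length a \<le> q"
    using length_subst_factor_strict_mono[OF substitution, of q "length a" u 0] a(1) q by (metis le_add1 not_le)
  then obtain p where p: "q = length a + p" by (auto simp: le_iff_add)
  have "factor u 0 q = a @ factor (v @- z) 0 p" unfolding p az by (rule factor_app_add)
  then have k: "k = length (W (factor (v @- z) 0 p))" using q by simp
  \<comment> \<open>At most \<open>k\<close> letters are involved, so they lie inside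
    \<open>v\<close> and are letters of \<open>x\<close>.\<close>
  then have "p \<le> k" using length_subst_word[OF substitution, of "factor (v @- z) 0 p"] by simp
  then have "factor (v @- z) 0 p = factor x 0 p" by (simp add: factor_app_le v_def take_factor)
  then show ?thesis using k by metis
qed

text \<open>\<open>T (sh 1 x)\<close> occurs in \<open>T x'\<close> at position
  \<open>length (\<tau> (x 0))\<close>, which is therefore a block boundary of \<open>x'\<close>
  beyond the first block. By symmetry the first blocks have equal length, hence are equal, and
  injectivity of \<open>\<tau>\<close> peels off one letter at a time.\<close>

lemma T_injective:
  assumes "x \<in> X" "x' \<in> X" "T x = T x'" shows "x = x'"
proof -
  have le: "length (\<tau> (x' 0)) \<le> length (\<tau> (x 0))" if "x \<in> X" "x' \<in> X" "T x = T x'" for x x'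
  proof -
    have one: "factor z 0 1 = [z 0]" for z :: "nat \<Rightarrow> 'a" by (simp add: factor_def)
    have "T x = \<tau> (x 0) @- T (sh 1 x)" using T_app cons_app by (metis subst_word_single)
    then have "sh (length (\<tau> (x 0))) (T x') = T (sh 1 x)" using that(3) by (metis sh_app)
    from cut_at_factor[OF that(2) sh_in_X[OF that(1)] this]
    obtain p where p: "length (\<tau> (x 0)) = length (W (factor x' 0 p))" by blast
    have "p \<noteq> 0" using p \<tau>_nonempty[of "x 0"] by (intro notI) simp
    then show ?thesis using length_subst_factor_mono[of 1 p \<tau> x' 0] one p by simp
  qed
  have step: "x 0 = x' 0 \<and> T (sh 1 x) = T (sh 1 x')" if "x \<in> X" "x' \<in> X" "T x = T x'" for x x'
  proof -
    have "\<tau> (x 0) @- T (sh 1 x) = \<tau> (x' 0) @- T (sh 1 x')"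
      using T_app cons_app that(3) by (metis subst_word_single)
    moreover have "length (\<tau> (x 0)) = length (\<tau> (x' 0))"
      using le[OF that] le[OF that(2,1)] that(3) by simp
    ultimately have "\<tau> (x 0) = \<tau> (x' 0)" "T (sh 1 x) = T (sh 1 x')" by (simp_all add: app_inject)
    then show ?thesis using inj by (auto dest: injD)
  qed
  have "T (sh i x) = T (sh i x')" for i
  proof (induction i)
    case (Suc i)
    then show ?case using step[of "sh i x" "sh i x'"] sh_in_X assms by (auto simp: sh_sh)
  qed (use assms in simp)
  then have "sh i x 0 = sh i x' 0" for i using step sh_in_X assms by blast
  then show ?thesis by (auto simp: sh_def)
qed

lemma recognizable_in_X:
  assumes "x \<in> X" "x' \<in> X" "sh k (T x) = T x'"
  shows "\<exists>p. k = length (W (factor x 0 p)) \<and> x' = sh p x"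
proof -
  obtain p where p: "k = length (W (factor x 0 p))" using cut_at_factor[OF assms] by blast
  then have "T (sh p x) = T x'" using subst_seq_split[OF substitution, of x p] assms(3) by (metis sh_app)
  then show ?thesis using T_injective sh_in_X assms p by metis
qed

subsection \<open>Self-similarity of the branch point\<close>

text \<open>Recognizability prevents either image from being a suffix of the other, so the longest
  common suffix \<open>s\<close> is preceded by different letters in \<open>\<tau> b\<close> and
  \<open>\<tau> b'\<close>. Thus \<open>s @- T y\<close> has two preimages and must be the branch
  point.\<close>

lemma common_suffix_branch:
  assumes b: "[b] @- y \<in> X" "[b'] @- y \<in> X" "b \<noteq> b'"
  shows "\<exists>s g g'. \<tau> b = g @ s \<and> \<tau> b' = g' @ s \<and> y = s @- T y"
proof -
  define s where "s = rev (longest_common_prefix (rev (\<tau> b)) (rev (\<tau> b')))"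
  obtain h where h: "rev (\<tau> b) = rev s @ h"
    using longest_common_prefix_prefix1[of "rev (\<tau> b)" "rev (\<tau> b')"] by (auto simp: s_def prefix_def)
  obtain h' where h': "rev (\<tau> b') = rev s @ h'"
    using longest_common_prefix_prefix2[of "rev (\<tau> b)" "rev (\<tau> b')"] by (auto simp: s_def prefix_def)
  have \<tau>b: "\<tau> b = rev h @ s" "\<tau> b' = rev h' @ s"
    using h h' by (metis rev_append rev_rev_ident)+
  \<comment> \<open>Otherwise \<open>T ([c] @- y)\<close> is a tail of \<open>T ([c'] @- y)\<close>
    that starts at the block boundary \<open>length g\<close>. Boundary 0 would identify the two
    points, and any later boundary lies beyond all of \<open>\<tau> c'\<close>, of which
    \<open>g\<close> is a proper prefix.\<close>
  have no_suffix: False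
    if "[c] @- y \<in> X" "[c'] @- y \<in> X" "c \<noteq> c'" "\<tau> c' = g @ \<tau> c" for c c' g
  proof -
    have "sh (length g) (T ([c'] @- y)) = T ([c] @- y)"
      using that(4) by (simp add: T_app app_append)
    from recognizable_in_X[OF that(2,1) this]
    obtain p where p: "length g = length (W (factor ([c'] @- y) 0 p))" "[c] @- y = sh p ([c'] @- y)"
      by blast
    show False
    proof (cases "p = 0")
      case True
      then show False using p(2) that(3) by (simp add: app_inject)
    next
      case False
      then have "length (\<tau> c') \<le> length g"
        using length_subst_factor_mono[of 1 p \<tau> "[c'] @- y" 0] p(1) by (simp add: factor_def app_def)
      then show False using that(4) \<tau>_nonempty[of c] by simp
    qed
  qed
  obtain c g where g: "rev h = g @ [c]"
    using no_suffix[OF b] \<tau>b by (cases h) auto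
  obtain c' g' where g': "rev h' = g' @ [c']"
    using no_suffix[OF b(2,1)] b(3) \<tau>b by (cases h') auto
  have "c \<noteq> c'"
  proof
    assume "c = c'"
    have hc: "h = c # rev g" "h' = c' # rev g'" using g g' by (simp_all add: rev_swap)
    then have "prefix (rev s @ [c]) (rev (\<tau> b))" "prefix (rev s @ [c]) (rev (\<tau> b'))"
      using h h' \<open>c = c'\<close> by (simp_all add: prefix_def)
    then have "prefix (rev s @ [c]) (rev s)"
      using longest_common_prefix_max_prefix by (fastforce simp: s_def)
    then show False using prefix_length_le by fastforce
  qed
  have 1: "[c] @- s @- T y = sh (length g) (T ([b] @- y))"
    by (simp add: T_app \<tau>b g app_append flip: app_append[of "[c]"])
  have 2: "[c'] @- s @- T y = sh (length g') (T ([b'] @- y))"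
    by (simp add: T_app \<tau>b g' app_append flip: app_append[of "[c']"])
  have "[c] @- s @- T y \<in> X" "[c'] @- s @- T y \<in> X"
    unfolding 1 2 using b by (auto intro: sh_in_X T_in_X)
  moreover have "sh 1 ([c] @- s @- T y) = sh 1 ([c'] @- s @- T y)"
    using sh_app[of "[c]"] sh_app[of "[c']"] by simp
  moreover have "[c] @- s @- T y \<noteq> [c'] @- s @- T y"
    using \<open>c \<noteq> c'\<close> by (simp add: app_inject)
  ultimately have "sh 1 ([c] @- s @- T y) = y" by (rule branchD)
  then have "s @- T y = y" using sh_app[of "[c]"] by simp
  then show ?thesis using \<tau>b by metis
qed

text \<open>Two different lengths would make \<open>T y\<close> periodic. Consequently the suffix
  from \<open>common_suffix_branch\<close> does not depend on the pair of letters.\<close>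

lemma prefix_of_y_unique:
  assumes "y = s @- T y" "y = s' @- T y" shows "s = s'"
proof -
  have no: False if "y = s @- T y" "y = s' @- T y" "length s < length s'" for s s'
  proof -
    have "sh (length s' - length s) (T y) = T y"
      using that by (metis sh_app sh_app_ge sh_sh le_add_diff_inverse2 less_imp_le)
    then show False using not_periodic[of "length s' - length s" "T y"] that(3) T_in_X y_in_X by simp
  qed
  have "length s = length s'" using no[OF assms] no[OF assms(2,1)] by (meson linorder_neqE_nat)
  then show ?thesis using assms app_inject by metis
qed

lemma ex_common_suffix:
  "\<exists>s. y = s @- T y \<and> (\<forall>b. [b] @- y \<in> X \<longrightarrow> (\<exists>g. \<tau> b = g @ s))"
proof -
  obtain b b' where b: "b \<noteq> b'" "[b] @- y \<in> X" "[b'] @- y \<in> X" using y_preimages by blast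
  obtain s where s: "y = s @- T y" using common_suffix_branch[OF b(2,3,1)] by blast
  have "\<exists>g. \<tau> c = g @ s" if c: "[c] @- y \<in> X" for c
  proof -
    obtain b'' where "b'' \<noteq> c" "[b''] @- y \<in> X" using b by metis
    then obtain s' g where "\<tau> c = g @ s'" "y = s' @- T y" using common_suffix_branch c by metis
    then show ?thesis using prefix_of_y_unique s by blast
  qed
  then show ?thesis using s by blast
qed

text \<open>The first condition holds for all large \<open>n\<close> by
  \<open>no_left_extension\<close>; the second holds as soon as the prefix reaches an occurrence of
  \<open>u 0\<close> in \<open>y\<close>, and will make the iterated images of the prefix
  grow.\<close>

lemma ex_prefix_length:
  "\<exists>n. (\<forall>b. b # factor y 0 n \<in> factors u \<longrightarrow> [b] @- y \<in> X) \<and> u 0 \<in> set (factor y 0 n)"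
proof -
  obtain n1 where n1: "\<And>b. [b] @- y \<notin> X \<Longrightarrow> b # factor y 0 n1 \<notin> factors u"
    using no_left_extension[of y] by blast
  obtain k where "agree 1 (sh k y) u" using visits y_in_X u_in_X by blast
  then have k: "y k = u 0" by (simp add: agree_def sh_def)
  define n where "n = max n1 (k + 1)"
  have "b # factor y 0 n1 \<in> factors u" if "b # factor y 0 n \<in> factors u" for b
    using that factors_sublist[of "[]" "b # factor y 0 n1" "factor y n1 (n - n1)" u]
      factor_add[of y 0 n1 "n - n1"] by (simp add: n_def)
  moreover have "u 0 \<in> set (factor y 0 n)"
    using k by (auto simp: factor_def n_def intro!: image_eqI[of _ _ k])
  ultimately show ?thesis using n1 by blast
qed

end

section \<open>Return words and towers\<close>

locale return_system = branching_substitution +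
  fixes s :: "'a list" and n :: nat
  assumes y_eq: "y = s @- T y"
    and suffix: "\<And>b. [b] @- y \<in> X \<Longrightarrow> \<exists>g. \<tau> b = g @ s"
    and left_letters: "\<And>b. b # factor y 0 n \<in> factors u \<Longrightarrow> [b] @- y \<in> X"
    and u0_in_prefix: "u 0 \<in> set (factor y 0 n)"
begin

definition C :: "(nat \<Rightarrow> 'a) set" where
  "C = {x \<in> X. agree n x y}"

definition \<theta> :: "(nat \<Rightarrow> 'a) \<Rightarrow> nat \<Rightarrow> 'a" where
  "\<theta> x = s @- T x"

definition ret :: "(nat \<Rightarrow> 'a) \<Rightarrow> nat" where
  "ret c = (LEAST t. 0 < t \<and> sh t c \<in> C)"

definition lab :: "(nat \<Rightarrow> 'a) \<Rightarrow> 'a list" where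
  "lab c = factor c 0 (ret c)"

definition nxt :: "(nat \<Rightarrow> 'a) \<Rightarrow> nat \<Rightarrow> 'a" where
  "nxt c = sh (ret c) c"

lemma C_in_X: "c \<in> C \<Longrightarrow> c \<in> X"
  by (simp add: C_def)

lemma y_in_C: "y \<in> C"
  by (simp add: C_def y_in_X)

lemma C_agree: "x \<in> C \<Longrightarrow> x' \<in> X \<Longrightarrow> agree n x x' \<Longrightarrow> x' \<in> C"
  unfolding C_def using agree_trans agree_sym by blast

lemma agree_in_C: "c \<in> C \<Longrightarrow> c' \<in> C \<Longrightarrow> agree n c c'"
  unfolding C_def using agree_trans agree_sym by blast

lemma left_letter_suffix:
  assumes "[b] @- c \<in> X" "c \<in> C" shows "\<exists>g. \<tau> b = g @ s"
proof -
  have "factor ([b] @- c) 0 (1 + n) \<in> factors u" using assms(1) mem_X by blast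
  then have "b # factor c 0 n \<in> factors u" using factor_app_add[of "[b]" c n] by simp
  then have "b # factor y 0 n \<in> factors u" using assms(2) by (simp add: C_def agree_factor)
  then show ?thesis using suffix left_letters by blast
qed

lemma \<theta>_y: "\<theta> y = y"
  by (simp add: \<theta>_def flip: y_eq)

lemma agree_\<theta>_strong:
  "agree m x x' \<Longrightarrow> agree (length s + length (W (factor x 0 m))) (\<theta> x) (\<theta> x')"
  unfolding \<theta>_def agree_app by (rule agree_subst_seq[OF substitution])

lemma agree_\<theta>: "agree m x x' \<Longrightarrow> agree m (\<theta> x) (\<theta> x')"
  using agree_mono[OF agree_\<theta>_strong, of m x x' m] length_subst_word[OF substitution, of "factor x 0 m"]
  by simp

text \<open>\<open>\<theta> c\<close> is in \<open>X\<close> because it is a tail of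
  \<open>T ([b] @- c)\<close> for a left extension of \<open>c\<close>. It stays in the cylinder
  because \<theta> preserves agreement with its fixed point \<open>y\<close>.\<close>

lemma \<theta>_in_C:
  assumes "c \<in> C" shows "\<theta> c \<in> C"
proof -
  obtain b where b: "[b] @- c \<in> X" using left_extension C_in_X assms by blast
  then obtain g where "\<tau> b = g @ s" using left_letter_suffix assms by blast
  then have "T ([b] @- c) = g @- \<theta> c" by (simp add: T_app \<theta>_def app_append)
  then have "\<theta> c \<in> X" using sh_in_X[OF T_in_X[OF b], of "length g"] by simp
  moreover have "agree n (\<theta> y) (\<theta> c)" using assms y_in_C agree_in_C agree_\<theta> by blast
  ultimately show ?thesis using C_agree[OF y_in_C] by (simp add: \<theta>_y)
qed

lemma \<theta>_injective: "c \<in> X \<Longrightarrow> c' \<in> X \<Longrightarrow> \<theta> c = \<theta> c' \<Longrightarrow> c = c'"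
  unfolding \<theta>_def using T_injective by simp

text \<open>A letter in front of a point of \<open>C\<close> is a left letter of \<open>y\<close>, so its image ends in \<open>s\<close>, and
  the block \<open>s\<close> in front of \<open>T c\<close> can be carried along the orbit from one visit to \<open>C\<close> to another.\<close>

lemma sh_\<theta>:
  assumes "c \<in> X" "sh q c \<in> C"
  shows "sh (length (W (factor c 0 q))) (\<theta> c) = \<theta> (sh q c)"
proof (cases q)
  case (Suc q')
  have eq: "[c q'] @- sh q c = sh q' c"
    using cons_app[of "sh q' c"] by (simp add: sh_sh Suc) (simp add: sh_def)
  then have "[c q'] @- sh q c \<in> X" using sh_in_X[OF assms(1)] by simp
  then obtain g where g: "\<tau> (c q') = g @ s" using left_letter_suffix assms(2) by blast
  have q: "factor c 0 q = factor c 0 q' @ [c q']" using factor_add[of c 0 q' 1] Suc by (simp add: factor_def)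
  have "T c = W (factor c 0 q) @- T (sh q c)" by (rule subst_seq_split[OF substitution])
  also have "\<dots> = (W (factor c 0 q') @ g) @- \<theta> (sh q c)" by (simp add: q g \<theta>_def app_append)
  finally have "\<theta> c = (s @ W (factor c 0 q') @ g) @- \<theta> (sh q c)" by (simp add: \<theta>_def[of c] app_append)
  moreover have "length (W (factor c 0 q)) = length (s @ W (factor c 0 q') @ g)" by (simp add: q g)
  ultimately show ?thesis by (metis sh_app)
qed simp

lemma ex_return:
  assumes "x \<in> X" shows "\<exists>t. 0 < t \<and> sh t x \<in> C"
proof -
  obtain t where "agree n (sh t (sh 1 x)) y" using visits[OF sh_in_X[OF assms] y_in_X] by blast
  then have "sh (t + 1) x \<in> C" using sh_in_X[OF assms] by (simp add: C_def sh_sh)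
  then show ?thesis by (intro exI[of _ "t + 1"]) simp
qed

lemma ret_pos: "x \<in> X \<Longrightarrow> 0 < ret x" and nxt_in_C: "x \<in> X \<Longrightarrow> nxt x \<in> C"
  using LeastI_ex[OF ex_return, of x] by (auto simp: ret_def nxt_def)

lemma ret_le: "0 < t \<Longrightarrow> sh t x \<in> C \<Longrightarrow> ret x \<le> t"
  unfolding ret_def by (rule Least_le) simp

lemma length_lab [simp]: "length (lab c) = ret c"
  by (simp add: lab_def)

lemma ret_bounded: "\<exists>B. \<forall>x\<in>X. ret x \<le> B"
proof -
  obtain B where B: "\<forall>x\<in>X. \<exists>t<B. agree n (sh t x) y"
    using bounded_visits[OF y_in_X, of n] by blast
  have "ret x \<le> B" if "x \<in> X" for x
  proof -
    from B[rule_format, OF sh_in_X[OF that]]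
    obtain t where "t < B" "agree n (sh t (sh 1 x)) y" by blast
    then have "sh (t + 1) x \<in> C" using sh_in_X[OF that] by (simp add: C_def sh_sh)
    then show ?thesis using ret_le[of "t + 1" x] \<open>t < B\<close> by simp
  qed
  then show ?thesis by blast
qed

lemma visit_agree:
  assumes "x' \<in> X" "agree (t + n) x x'" "sh t x \<in> C" shows "sh t x' \<in> C"
  using C_agree[OF assms(3) sh_in_X[OF assms(1)] agree_sh[OF assms(2)]] .

text \<open>\<open>ret x + n\<close> letters show the first return and rule out earlier ones, so
  labels are locally constant.\<close>

lemma lab_agree:
  assumes "x \<in> X" "x' \<in> X" "agree (ret x + n) x x'" shows "lab x' = lab x"
proof -
  have "ret x' \<le> ret x"
    using visit_agree[OF assms(2,3)] nxt_in_C ret_pos assms(1) by (intro ret_le) (auto simp: nxt_def)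
  moreover have "ret x \<le> ret x'"
  proof (rule ret_le)
    have "agree (ret x' + n) x' x" using assms(3) \<open>ret x' \<le> ret x\<close> by (auto simp: agree_def)
    then show "sh (ret x') x \<in> C" using visit_agree assms nxt_in_C by (simp add: nxt_def)
  qed (use ret_pos assms in simp)
  ultimately have "ret x = ret x'" by simp
  then show ?thesis using agree_mono[OF assms(3), of "ret x"] by (simp add: lab_def agree_factor)
qed

lemma closedin_lab: "closedin XT {c \<in> C. P (lab c)}"
  unfolding closedin_XT
proof (intro conjI ballI)
  fix x assume x: "x \<in> X - {c \<in> C. P (lab c)}"
  have "x' \<notin> {c \<in> C. P (lab c)}" if x': "x' \<in> X" "agree (ret x + n) x x'" for x'
  proof
    assume "x' \<in> {c \<in> C. P (lab c)}"
    then have "x' \<in> C" "P (lab x')" by auto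
    moreover have "x \<in> C"
      using C_agree[OF \<open>x' \<in> C\<close>] agree_sym[OF agree_mono[OF x'(2), of n]] x by simp
    moreover have "lab x' = lab x" using lab_agree x' x by blast
    ultimately show False using x by simp
  qed
  then show "\<exists>m. \<forall>x'\<in>X. agree m x x' \<longrightarrow> x' \<notin> {c \<in> C. P (lab c)}" by blast
qed (use C_in_X in auto)

lemma closedin_C: "closedin XT C"
  using closedin_lab[of "\<lambda>_. True"] by simp

lemma finite_lab: "finite (lab ` C)"
proof -
  obtain B where "\<forall>x\<in>X. ret x \<le> B" using ret_bounded by blast
  then have "lab ` C \<subseteq> {w. set w \<subseteq> UNIV \<and> length w \<le> B}" using C_in_X by auto
  then show ?thesis by (rule finite_subset[OF _ finite_lists_length_le[OF finite_class.finite_UNIV]])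
qed

end

text \<open>\<open>X\<close> is partitioned into the towers over the sets \<open>g c\<close> with \<open>lab c = r\<close>, of height \<open>h r\<close>.
  The floors are disjoint because two points whose orbits merge do so at \<open>y\<close>, which lies in the base.\<close>

locale tower = return_system +
  fixes g :: "(nat \<Rightarrow> 'a) \<Rightarrow> nat \<Rightarrow> 'a" and h :: "'a list \<Rightarrow> nat"
  assumes g_in_C: "\<And>c. c \<in> C \<Longrightarrow> g c \<in> C"
    and g_injective: "\<And>c c'. c \<in> C \<Longrightarrow> c' \<in> C \<Longrightarrow> g c = g c' \<Longrightarrow> c = c'"
    and agree_g: "\<And>m c c'. c \<in> C \<Longrightarrow> c' \<in> C \<Longrightarrow> agree m c c' \<Longrightarrow> agree m (g c) (g c')"
    and h_pos: "\<And>c. c \<in> C \<Longrightarrow> 0 < h (lab c)"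
    and g_step: "\<And>c. c \<in> C \<Longrightarrow> sh (h (lab c)) (g c) = g (nxt c)"
    and g_return: "\<And>c c' t. c \<in> C \<Longrightarrow> c' \<in> C \<Longrightarrow> 0 < t \<Longrightarrow> sh t (g c) = g c' \<Longrightarrow> h (lab c) \<le> t"
    and g_y: "g y = y"
begin

lemma floor_unique:
  assumes "c \<in> C" "t < h (lab c)" "c' \<in> C" "t' < h (lab c')" "sh t (g c) = sh t' (g c')"
  shows "c = c' \<and> t = t'"
proof -
  have *: "c = c' \<and> t = t'"
    if c: "c \<in> C" "t < h (lab c)" "c' \<in> C" "t' < h (lab c')" "sh t (g c) = sh t' (g c')" "t \<le> t'"
    for c c' t t'
  proof -
    have X: "g c \<in> X" "sh (t' - t) (g c') \<in> X" using c g_in_C C_in_X sh_in_X by blast+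
    have "g c = sh (t' - t) (g c')"
    proof (rule ccontr)
      \<comment> \<open>Distinct points would merge at \<open>y = g y\<close> after at most
        \<open>t\<close> steps, a return to the base before the tower over \<open>g c\<close>
        ends.\<close>
      assume "g c \<noteq> sh (t' - t) (g c')"
      moreover have "sh t (g c) = sh t (sh (t' - t) (g c'))" using c(5,6) by (simp add: sh_sh)
      ultimately obtain i where i: "0 < i" "i \<le> t" "sh i (g c) = y"
        using branch_between[OF X] by blast
      then have "h (lab c) \<le> i" using g_return[OF c(1) y_in_C] g_y by simp
      then show False using i c by simp
    qed
    \<comment> \<open>If \<open>t' - t\<close> were positive, the orbit of \<open>g c'\<close> would
      re-enter the base below the top of its tower.\<close>
    moreover from this have "t = t'" using g_return[OF c(3,1), of "t' - t"] c(4,6) by fastforce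
    ultimately show ?thesis using c g_injective by simp
  qed
  show ?thesis
  proof (cases "t \<le> t'")
    case True
    then show ?thesis using *[OF assms] by simp
  next
    case False
    then show ?thesis using *[OF assms(3,4,1,2) assms(5)[symmetric]] by simp
  qed
qed

text \<open>There are finitely many labels, so the heights are bounded and the set is a finite union
  of images of closed sets. Letting \<open>Z\<close> depend on \<open>t\<close> allows conditions
  that involve base point and height together.\<close>

lemma closedin_floors:
  assumes "\<And>t. closedin XT (Z t)" "\<And>t. Z t \<subseteq> C"
  shows "closedin XT {sh t (g c) | t c. c \<in> Z t \<and> t < h (lab c)}"
proof -
  have "finite ((\<lambda>c. h (lab c)) ` C)" using finite_imageI[OF finite_lab, of h] by (simp add: image_image)
  then obtain H where H: "\<And>c. c \<in> C \<Longrightarrow> h (lab c) < H" using finite_nat_bounded[of "(\<lambda>c. h (lab c)) ` C"] by auto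
  have "closedin XT ((\<lambda>c. sh t (g c)) ` (Z t \<inter> {c \<in> C. t < h (lab c)}))" for t
  proof (rule closedin_image[where S = C])
    show "closedin XT (Z t \<inter> {c \<in> C. t < h (lab c)})"
      using assms(1) closedin_lab[of "\<lambda>r. t < h r"] by (rule closedin_Int)
    show "\<exists>m. \<forall>x\<in>C. \<forall>x'\<in>C. agree m x x' \<longrightarrow> agree i (sh t (g x)) (sh t (g x'))" for i
      using agree_g agree_sh by (intro exI[of _ "t + i"]) blast
  qed (use g_in_C C_in_X sh_in_X in auto)
  then have "closedin XT (\<Union>t<H. (\<lambda>c. sh t (g c)) ` (Z t \<inter> {c \<in> C. t < h (lab c)}))"
    by (intro closedin_Union) auto
  moreover have "(\<Union>t<H. (\<lambda>c. sh t (g c)) ` (Z t \<inter> {c \<in> C. t < h (lab c)})) =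
      {sh t (g c) | t c. c \<in> Z t \<and> t < h (lab c)}" (is "?A = ?B")
  proof
    show "?A \<subseteq> ?B" by blast
    show "?B \<subseteq> ?A"
    proof
      fix x assume "x \<in> ?B"
      then obtain t c where tc: "x = sh t (g c)" "c \<in> Z t" "t < h (lab c)" by blast
      moreover have "c \<in> C" using assms(2) tc(2) by blast
      moreover have "t < H" using H[OF \<open>c \<in> C\<close>] tc(3) by simp
      ultimately show "x \<in> ?A" by blast
    qed
  qed
  ultimately show ?thesis by simp
qed

text \<open>The union of the floors is closed, contains \<open>y\<close>, and is invariant: a step
  goes one floor up or, from the top, to the base of the next tower. Minimality does the
  rest.\<close>

lemma floor_exists:
  assumes "x \<in> X" shows "\<exists>c t. c \<in> C \<and> t < h (lab c) \<and> x = sh t (g c)"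
proof -
  define Z where "Z = {sh t (g c) | t c. c \<in> C \<and> t < h (lab c)}"
  have "closedin XT Z" unfolding Z_def by (rule closedin_floors) (use closedin_C in auto)
  moreover have "y \<in> Z" unfolding Z_def using y_in_C g_y h_pos[OF y_in_C] by (force intro: exI[of _ 0])
  moreover have "sh 1 z \<in> Z" if "z \<in> Z" for z
  proof -
    from that obtain t c where tc: "z = sh t (g c)" "c \<in> C" "t < h (lab c)" unfolding Z_def by blast
    show ?thesis
    proof (cases "t + 1 < h (lab c)")
      case True
      then show ?thesis using tc unfolding Z_def by (auto simp: sh_sh intro!: exI[of _ "Suc t"])
    next
      case False
      then have "sh 1 z = sh 0 (g (nxt c))" using tc g_step[OF tc(2)] by (simp add: sh_sh)
         (metis Suc_leI le_antisym linorder_not_less)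
      then show ?thesis unfolding Z_def using nxt_in_C[of c] C_in_X[OF tc(2)] h_pos by blast
    qed
  qed
  ultimately have "Z = X" by (rule minimal_closed)
  then show ?thesis using assms unfolding Z_def by blast
qed

definition base :: "(nat \<Rightarrow> 'a) \<Rightarrow> nat \<Rightarrow> 'a" where
  "base x = (THE c. c \<in> C \<and> (\<exists>t<h (lab c). x = sh t (g c)))"

definition hgt :: "(nat \<Rightarrow> 'a) \<Rightarrow> nat" where
  "hgt x = (THE t. t < h (lab (base x)) \<and> x = sh t (g (base x)))"

lemma base_eq:
  assumes c: "c \<in> C" "t < h (lab c)" shows "base (sh t (g c)) = c"
  unfolding base_def
proof (rule the_equality)
  fix c' assume "c' \<in> C \<and> (\<exists>t'<h (lab c'). sh t (g c) = sh t' (g c'))"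
  then obtain t' where "c' \<in> C" "t' < h (lab c')" "sh t (g c) = sh t' (g c')" by blast
  from floor_unique[OF c this] show "c' = c" by simp
qed (use c in blast)

lemma hgt_eq:
  assumes c: "c \<in> C" "t < h (lab c)" shows "hgt (sh t (g c)) = t"
  unfolding hgt_def base_eq[OF c]
proof (rule the_equality)
  fix t' assume "t' < h (lab c) \<and> sh t (g c) = sh t' (g c)"
  then show "t' = t" using floor_unique[OF c c(1)] by blast
qed (use c in blast)

lemma base_g: "c \<in> C \<Longrightarrow> base (g c) = c" and hgt_g: "c \<in> C \<Longrightarrow> hgt (g c) = 0"
  using base_eq[of c 0] hgt_eq[of c 0] h_pos[of c] by auto

lemma
  assumes "x \<in> X"
  shows base_in_C: "base x \<in> C" and hgt_less: "hgt x < h (lab (base x))"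
    and floor_of: "sh (hgt x) (g (base x)) = x"
proof -
  obtain c t where "c \<in> C" "t < h (lab c)" and x: "x = sh t (g c)" using floor_exists[OF assms] by blast
  then show "base x \<in> C" "hgt x < h (lab (base x))" "sh (hgt x) (g (base x)) = x"
    by (simp_all add: base_eq hgt_eq)
qed

lemma closedin_base_hgt:
  assumes "\<And>t. closedin XT (Z t)" "\<And>t. Z t \<subseteq> C"
  shows "closedin XT {x \<in> X. base x \<in> Z (hgt x)}"
proof -
  have "{x \<in> X. base x \<in> Z (hgt x)} = {sh t (g c) | t c. c \<in> Z t \<and> t < h (lab c)}" (is "?A = ?B")
  proof
    show "?A \<subseteq> ?B" using hgt_less floor_of by force
    show "?B \<subseteq> ?A"
    proof
      fix x assume "x \<in> ?B"
      then obtain t c where tc: "x = sh t (g c)" "c \<in> Z t" "t < h (lab c)" by blast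
      then have "c \<in> C" using assms(2) by blast
      then show "x \<in> ?A" using tc base_eq hgt_eq g_in_C C_in_X sh_in_X by simp
    qed
  qed
  then show ?thesis using closedin_floors[OF assms] by simp
qed

end

lemma agree_add:
  assumes "agree q x x'" "agree m (sh q x) (sh q x')" shows "agree (q + m) x x'"
  using assms by (metis agree_app app_factor agree_factor length_factor)

section \<open>Renormalization of \<open>C\<close>: the map \<open>D\<close> and its odometer
  rule\<close>

context return_system
begin

text \<open>Above the top floor comes \<open>\<theta> (nxt c)\<close>, a point of \<open>C\<close>,
  so no return to \<open>C\<close> jumps past the end of the tower.\<close>

lemma return_before_level:
  assumes "c \<in> C" "t < length (W (lab c))"
  shows "t + ret (sh t (\<theta> c)) \<le> length (W (lab c))"
proof -
  have "sh (length (W (lab c))) (\<theta> c) \<in> C"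
    using sh_\<theta>[of c "ret c"] nxt_in_C \<theta>_in_C C_in_X assms(1) by (simp add: lab_def nxt_def)
  then have "sh (length (W (lab c)) - t) (sh t (\<theta> c)) \<in> C" using assms(2) by (simp add: sh_sh)
  then show ?thesis using ret_le[of "length (W (lab c)) - t"] assms(2) by fastforce
qed

sublocale floor: tower \<tau> u y s n "\<lambda>c. c" length
proof
  show "length (lab c) \<le> t" if "c' \<in> C" "0 < t" "sh t c = c'" for c c' t
    using that ret_le by simp
qed (auto simp: nxt_def ret_pos C_in_X)

sublocale level: tower \<tau> u y s n \<theta> "\<lambda>r. length (W r)"
proof
  fix c assume c: "c \<in> C"
  show "0 < length (W (lab c))"
    using length_subst_word[OF substitution, of "lab c"] ret_pos[OF C_in_X[OF c]] by fastforce
  show "sh (length (W (lab c))) (\<theta> c) = \<theta> (nxt c)"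
    using sh_\<theta>[of c "ret c"] nxt_in_C C_in_X c by (simp add: lab_def nxt_def)
next
  fix c c' t assume c: "c \<in> C" "c' \<in> C" "0 < t" and eq: "sh t (\<theta> c) = \<theta> c'"
  \<comment> \<open>Dropping \<open>s\<close> turns a return to \<theta>(C) into an occurrence of
    \<open>T c'\<close> in \<open>T c\<close>, and recognizability identifies it as a visit
    \<open>c' = sh p c\<close> to \<open>C\<close>.\<close>
  have "sh t (T c) = sh (length s) (sh t (\<theta> c))" by (simp add: \<theta>_def sh_sh add.commute sh_app_ge)
  then have "sh t (T c) = T c'" unfolding eq by (simp add: \<theta>_def)
  then obtain p where p: "t = length (W (factor c 0 p))" "c' = sh p c"
    using recognizable_in_X c C_in_X by blast
  then have "0 < p" using c(3) by (cases p) auto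
  then have "ret c \<le> p" using ret_le p(2) c(2) by simp
  then show "length (W (lab c)) \<le> t" unfolding lab_def p(1) by (rule length_subst_factor_mono)
qed (auto simp: \<theta>_in_C \<theta>_y agree_\<theta> intro: \<theta>_injective C_in_X)

text \<open>\<open>D\<close> climbs one level of the diagram: it takes \<open>c\<close> to the
  \<open>d\<close> in \<open>C\<close> for which \<open>c\<close> lies in the tower over
  \<open>\<theta> d\<close>, and \<open>dt c\<close> is the floor.\<close>

abbreviation "D \<equiv> level.base"
abbreviation "dt \<equiv> level.hgt"

lemma D_in_C: "c \<in> C \<Longrightarrow> D c \<in> C"
  using level.base_in_C C_in_X by blast

lemma Dk_in_C: "c \<in> C \<Longrightarrow> (D ^^ k) c \<in> C"
  by (induction k) (auto intro: D_in_C)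

lemma \<theta>k_in_C: "c \<in> C \<Longrightarrow> (\<theta> ^^ k) c \<in> C"
  by (induction k) (auto intro: \<theta>_in_C)

lemma Dk_\<theta>k: "c \<in> C \<Longrightarrow> (D ^^ k) ((\<theta> ^^ k) c) = c"
proof (induction k)
  case (Suc k)
  have "(D ^^ Suc k) ((\<theta> ^^ Suc k) c) = (D ^^ k) (D (\<theta> ((\<theta> ^^ k) c)))" by (simp add: funpow_swap1)
  then show ?case using Suc by (simp add: level.base_g \<theta>k_in_C)
qed simp

lemma level_of: "c \<in> C \<Longrightarrow> sh (dt c) (\<theta> (D c)) = c"
  and dt_less: "c \<in> C \<Longrightarrow> dt c < length (W (lab (D c)))"
  using level.floor_of level.hgt_less C_in_X by auto

lemma dt_ret_le: "c \<in> C \<Longrightarrow> dt c + ret c \<le> length (W (lab (D c)))"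
  using return_before_level[OF D_in_C dt_less, of c] level_of by simp

text \<open>Together with \<open>nxt_carry\<close> one step of an odometer: the next visit to
  \<open>C\<close> stays in the tower over \<open>\<theta> (D c)\<close>, or it completes that tower
  and the step is passed on to \<open>D c\<close>.\<close>

lemma nxt_inner:
  assumes "c \<in> C" "dt c + ret c < length (W (lab (D c)))"
  shows "D (nxt c) = D c" "dt (nxt c) = dt c + ret c"
proof -
  have "nxt c = sh (dt c + ret c) (\<theta> (D c))"
    using level_of[OF assms(1)] by (metis add.commute nxt_def sh_sh)
  then show "D (nxt c) = D c" "dt (nxt c) = dt c + ret c"
    using level.base_eq level.hgt_eq D_in_C assms by auto
qed

lemma nxt_carry:
  assumes "c \<in> C" "dt c + ret c = length (W (lab (D c)))"
  shows "nxt c = \<theta> (nxt (D c))" "D (nxt c) = nxt (D c)" "dt (nxt c) = 0"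
proof -
  have "nxt c = sh (dt c + ret c) (\<theta> (D c))"
    using level_of[OF assms(1)] by (metis add.commute nxt_def sh_sh)
  then show *: "nxt c = \<theta> (nxt (D c))"
    using level.g_step[OF D_in_C[OF assms(1)]] assms(2) by simp
  have "nxt (D c) \<in> C" using nxt_in_C C_in_X D_in_C assms(1) by blast
  from level.base_g[OF this] level.hgt_g[OF this] *
  show "D (nxt c) = nxt (D c)" "dt (nxt c) = 0" by simp_all
qed

lemma nxt_cases:
  assumes "c \<in> C"
  obtains "dt c + ret c < length (W (lab (D c)))" | "dt c + ret c = length (W (lab (D c)))"
  using dt_ret_le[OF assms] le_neq_implies_less by blast

section \<open>Points deep in the towers\<close>

text \<open>All points of \<open>C\<close> share their first \<open>n\<close> letters, and \<theta>
  turns a common prefix \<open>p\<close> into the common prefix \<open>s @ W p\<close>.\<close>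

lemma \<theta>k_prefix:
  "\<exists>v. \<forall>c\<in>C. \<exists>z. (\<theta> ^^ k) c = v @- (subst_word \<tau> ^^ k) (factor y 0 n) @- z"
proof (induction k)
  case 0
  have "c = factor y 0 n @- sh n c" if "c \<in> C" for c
    using that app_factor[of c n] by (simp add: C_def agree_factor)
  then show ?case by (intro exI[of _ "[]"]) auto
next
  case (Suc k)
  then obtain v where v: "\<forall>c\<in>C. \<exists>z. (\<theta> ^^ k) c = v @- (subst_word \<tau> ^^ k) (factor y 0 n) @- z" ..
  have "\<exists>z. (\<theta> ^^ Suc k) c = (s @ W v) @- (subst_word \<tau> ^^ Suc k) (factor y 0 n) @- z" if "c \<in> C" for c
  proof -
    obtain z where "(\<theta> ^^ k) c = v @- (subst_word \<tau> ^^ k) (factor y 0 n) @- z"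
      using bspec[OF v \<open>c \<in> C\<close>] ..
    then have "(\<theta> ^^ Suc k) c = (s @ W v) @- (subst_word \<tau> ^^ Suc k) (factor y 0 n) @- T z"
      by (simp add: \<theta>_def T_app app_append)
    then show ?thesis by (rule exI[of _ "T z"])
  qed
  then show ?case by (intro exI[of _ "s @ W v"] ballI)
qed

lemma \<theta>k_y: "(\<theta> ^^ k) y = y"
  by (induction k) (auto simp: \<theta>_y)

text \<open>The common prefix of \<theta>^k(C) is also a prefix of \<open>y\<close>, since \<theta>
  fixes \<open>y\<close>, and it contains the \<open>k\<close>-th image of \<open>u 0\<close>, whose
  length tends to infinity.\<close>

lemma \<theta>k_agree_y: "\<exists>k0. \<forall>k\<ge>k0. \<forall>c\<in>C. agree m y ((\<theta> ^^ k) c)"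
proof -
  have "filterlim (\<lambda>k. length (subst_pow \<tau> k (u 0))) at_top sequentially"
    using fixed_point by (simp add: generating_fixed_point_def)
  then have "eventually (\<lambda>k. m \<le> length (subst_pow \<tau> k (u 0))) sequentially"
    by (simp add: filterlim_at_top)
  then obtain k0 where k0: "\<forall>k\<ge>k0. m \<le> length (subst_pow \<tau> k (u 0))"
    unfolding eventually_sequentially ..
  have "agree m y ((\<theta> ^^ k) c)" if "k \<ge> k0" "c \<in> C" for k c
  proof -
    define w where "w = (subst_word \<tau> ^^ k) (factor y 0 n)"
    obtain v where v: "\<forall>c\<in>C. \<exists>z. (\<theta> ^^ k) c = v @- w @- z" unfolding w_def using \<theta>k_prefix ..
    obtain z where z: "(\<theta> ^^ k) c = (v @ w) @- z"
      using bspec[OF v \<open>c \<in> C\<close>] unfolding app_append ..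
    obtain z' where z': "y = (v @ w) @- z'"
      using bspec[OF v y_in_C] unfolding \<theta>k_y app_append ..
    obtain a b where ab: "factor y 0 n = a @ [u 0] @ b" using split_list[OF u0_in_prefix] by auto
    have "length (subst_pow \<tau> k (u 0)) \<le> length w"
      unfolding w_def ab by (simp add: funpow_subst_word_append subst_pow_def del: append_Cons)
    then have "m \<le> length (v @ w)" using k0 \<open>k \<ge> k0\<close> by fastforce
    moreover have "agree (length (v @ w)) y ((\<theta> ^^ k) c)"
      unfolding z agree_factor factor_app by (subst z') (rule factor_app)
    ultimately show ?thesis using agree_mono by blast
  qed
  then show ?thesis by blast
qed

text \<open>Labels and heights of the first levels determine the letters up to some entry into
  \<theta>^k(C). In the induction step the \<open>q\<close> common letters of \<open>D c\<close> and
  \<open>D c'\<close> are blown up by \<theta>, and the first \<open>dt c\<close> letters are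
  removed.\<close>

lemma same_path_agree:
  assumes "c \<in> C" "c' \<in> C"
    and "\<And>i. i \<le> k \<Longrightarrow> lab ((D ^^ i) c) = lab ((D ^^ i) c')"
    and "\<And>i. i < k \<Longrightarrow> dt ((D ^^ i) c) = dt ((D ^^ i) c')"
  shows "\<exists>q>0. agree q c c' \<and> sh q c \<in> (\<theta> ^^ k) ` C \<and> sh q c' \<in> (\<theta> ^^ k) ` C"
  using assms
proof (induction k arbitrary: c c')
  case 0
  have "lab c = lab c'" using 0(3)[of 0] by simp
  moreover from this have "ret c = ret c'" by (metis length_lab)
  ultimately have "agree (ret c) c c'" by (simp add: agree_factor lab_def)
  then show ?case using nxt_in_C[of c] nxt_in_C[of c'] C_in_X 0(1,2) ret_pos[of c] \<open>ret c = ret c'\<close>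
    by (intro exI[of _ "ret c"]) (auto simp: nxt_def)
next
  case (Suc k)
  define d d' t where "d = D c" "d' = D c'" "t = dt c"
  have C: "d \<in> C" "d' \<in> C" using Suc.prems d_d'_t_def D_in_C by auto
  have "lab ((D ^^ i) d) = lab ((D ^^ i) d')" if "i \<le> k" for i
    using Suc.prems(3)[of "Suc i"] that by (simp add: d_d'_t_def funpow_swap1)
  moreover have "dt ((D ^^ i) d) = dt ((D ^^ i) d')" if "i < k" for i
    using Suc.prems(4)[of "Suc i"] that by (simp add: d_d'_t_def funpow_swap1)
  ultimately obtain q where q: "q > 0" "agree q d d'" "sh q d \<in> (\<theta> ^^ k) ` C" "sh q d' \<in> (\<theta> ^^ k) ` C"
    using Suc.IH C by metis
  have t: "c = sh t (\<theta> d)" "c' = sh t (\<theta> d')"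
    using level_of[OF Suc.prems(1)] level_of[OF Suc.prems(2)] Suc.prems(4)[of 0]
    by (simp_all add: d_d'_t_def)
  have qC: "sh q d \<in> C" "sh q d' \<in> C" using q(3,4) \<theta>k_in_C by auto
  define l where "l = length (W (factor d 0 q))"
  have l': "l = length (W (factor d' 0 q))" using q(2) by (simp add: l_def agree_factor)
  \<comment> \<open>Something must remain after the removal: \<open>t\<close> is below the top of
    the tower over \<open>\<theta> d\<close>, and \<open>q\<close> covers at least one full return
    of \<open>d\<close>.\<close>
  have "t < length (W (factor d 0 (ret d)))" using dt_less[OF Suc.prems(1)] by (simp add: d_d'_t_def lab_def)
  also have "\<dots> \<le> l" unfolding l_def using ret_le[OF q(1) qC(1)] by (rule length_subst_factor_mono)
  finally have "t < l" .
  have "sh l (\<theta> d) = \<theta> (sh q d)" "sh l (\<theta> d') = \<theta> (sh q d')"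
    using sh_\<theta>[OF C_in_X[OF C(1)] qC(1)] sh_\<theta>[OF C_in_X[OF C(2)] qC(2)] l' by (simp_all add: l_def)
  then have "sh (l - t) c = \<theta> (sh q d)" "sh (l - t) c' = \<theta> (sh q d')"
    using \<open>t < l\<close> by (simp_all add: t sh_sh)
  moreover have "\<theta> z \<in> (\<theta> ^^ Suc k) ` C" if "z \<in> (\<theta> ^^ k) ` C" for z
    using that by auto
  moreover have "agree (l - t) c c'"
    unfolding t using \<open>t < l\<close> agree_mono[OF agree_\<theta>_strong[OF q(2)], of l]
    by (intro agree_sh) (simp add: l_def)
  ultimately show ?case using q(3,4) \<open>t < l\<close> by (intro exI[of _ "l - t"]) simp
qed

lemma same_path_eq:
  assumes "c \<in> C" "c' \<in> C"
    and "\<And>i. lab ((D ^^ i) c) = lab ((D ^^ i) c')" "\<And>i. dt ((D ^^ i) c) = dt ((D ^^ i) c')"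
  shows "c = c'"
proof (rule eq_if_agree_all)
  fix m
  obtain k where k: "\<forall>c\<in>C. agree m y ((\<theta> ^^ k) c)" using \<theta>k_agree_y[of m] by blast
  have "\<exists>q>0. agree q c c' \<and> sh q c \<in> (\<theta> ^^ k) ` C \<and> sh q c' \<in> (\<theta> ^^ k) ` C"
    by (intro same_path_agree assms)
  then obtain q where q: "agree q c c'" "sh q c \<in> (\<theta> ^^ k) ` C" "sh q c' \<in> (\<theta> ^^ k) ` C"
    by blast
  \<comment> \<open>From the entry into \<theta>^k(C) on, both points look like \<open>y\<close> for
    \<open>m\<close> more letters.\<close>
  have "agree m y (sh q c)" "agree m y (sh q c')" using q(2,3) k by auto
  then have "agree m (sh q c) (sh q c')" using agree_sym agree_trans by blast
  then show "agree m c c'" using agree_add[OF q(1)] agree_mono by (meson le_add2)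
qed

text \<open>The \<open>k\<close>-th base point changes only if all \<open>k\<close> coordinates
  below it carry, and such a carry lands in \<theta>^k(C).\<close>

lemma Dk_nxt: "c \<in> C \<Longrightarrow> (D ^^ k) (nxt c) = (D ^^ k) c \<or> nxt c \<in> (\<theta> ^^ k) ` C"
proof (induction k arbitrary: c)
  case 0
  then show ?case using nxt_in_C C_in_X by auto
next
  case (Suc k)
  show ?case
  proof (rule nxt_cases[OF Suc.prems])
    assume "dt c + ret c < length (W (lab (D c)))"
    then show ?thesis using nxt_inner[OF Suc.prems] by (simp add: funpow_swap1)
  next
    assume *: "dt c + ret c = length (W (lab (D c)))"
    have "(D ^^ Suc k) (nxt c) = (D ^^ k) (nxt (D c))" "(D ^^ Suc k) c = (D ^^ k) (D c)"
      using nxt_carry[OF Suc.prems *] by (simp_all add: funpow_swap1)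
    then show ?thesis
      using Suc.IH[OF D_in_C[OF Suc.prems]] nxt_carry(1)[OF Suc.prems *] by auto
  qed
qed

lemma Dk_sh:
  assumes "c \<in> C" "sh q c \<in> C" "\<And>i. 0 < i \<Longrightarrow> i \<le> q \<Longrightarrow> sh i c \<notin> (\<theta> ^^ k) ` C"
  shows "(D ^^ k) (sh q c) = (D ^^ k) c"
  using assms
proof (induction q arbitrary: c rule: less_induct)
  case (less q)
  show ?case
  proof (cases "q = 0")
    case False
    then have le: "ret c \<le> q" using ret_le less.prems by simp
    have pos: "0 < ret c" using ret_pos C_in_X less.prems by blast
    have "nxt c \<notin> (\<theta> ^^ k) ` C" unfolding nxt_def using pos le less.prems(3) by blast
    then have "(D ^^ k) (nxt c) = (D ^^ k) c" using Dk_nxt less.prems(1) by blast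
    moreover have "sh (q - ret c) (nxt c) = sh q c" using le by (simp add: nxt_def sh_sh)
    moreover have "(D ^^ k) (sh (q - ret c) (nxt c)) = (D ^^ k) (nxt c)"
    proof (rule less.IH)
      show "sh i (nxt c) \<notin> (\<theta> ^^ k) ` C" if "0 < i" "i \<le> q - ret c" for i
        using less.prems(3)[of "i + ret c"] that le by (simp add: nxt_def sh_sh)
    qed (use pos le less.prems nxt_in_C C_in_X in \<open>auto simp: nxt_def sh_sh\<close>)
    ultimately show ?thesis by simp
  qed simp
qed

text \<open>For large \<open>k\<close> the points of \<theta>^k(C) share a long prefix with
  \<open>y\<close>; a return after \<open>i \<le> b\<close> steps would give that prefix period
  \<open>i\<close>, but \<open>y\<close> is not periodic.\<close>

lemma late_returns:
  "\<exists>k0. \<forall>k\<ge>k0. \<forall>z\<in>(\<theta> ^^ k) ` C. \<forall>i. 0 < i \<and> i \<le> b \<longrightarrow> sh i z \<notin> (\<theta> ^^ k) ` C"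
proof -
  have "\<exists>j. y (j + i) \<noteq> y j" if "0 < i" for i
    using not_periodic[OF that y_in_X] by (auto simp: sh_def fun_eq_iff)
  then obtain j where j: "\<And>i. 0 < i \<Longrightarrow> y (j i + i) \<noteq> y (j i)" by metis
  \<comment> \<open>Long enough to see the violation \<open>y (j i + i) \<noteq> y (j i)\<close> for
    every positive \<open>i \<le> b\<close>.\<close>
  define m where "m = Suc (Max ((\<lambda>i. j i + i) ` {..b}))"
  have m: "j i + i < m" if "i \<le> b" for i
    unfolding m_def less_Suc_eq_le using that by (intro Max_ge) auto
  obtain k0 where k0: "\<forall>k\<ge>k0. \<forall>c\<in>C. agree m y ((\<theta> ^^ k) c)" using \<theta>k_agree_y by blast
  have False if "k \<ge> k0" "z \<in> (\<theta> ^^ k) ` C" "0 < i" "i \<le> b" "sh i z \<in> (\<theta> ^^ k) ` C" for k z i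
  proof -
    have "agree m y z" "agree m y (sh i z)" using k0 that by auto
    then have "y (j i + i) = z (j i + i)" "y (j i) = z (j i + i)"
      using m[OF \<open>i \<le> b\<close>] by (auto simp: agree_def sh_def)
    then show False using j[OF \<open>0 < i\<close>] by simp
  qed
  then show ?thesis by blast
qed

text \<open>Every label recurs within \<open>b\<close> steps, while for large \<open>k\<close> the
  orbit of \<open>(\<theta> ^^ k) d\<close> avoids \<theta>^k(C) during these steps. So every label
  is met while \<open>D ^^ k\<close> still has the value \<open>d\<close>. This is simplicity of the
  diagram in dynamical terms.\<close>

lemma lab_connected:
  "\<exists>k\<ge>1. \<forall>r\<in>lab ` C. \<forall>r'\<in>lab ` C. \<exists>c\<in>C. lab c = r \<and> lab ((D ^^ k) c) = r'"
proof -
  have "\<forall>r\<in>lab ` C. \<exists>b. \<forall>x\<in>X. \<exists>t<b. sh t x \<in> C \<and> lab (sh t x) = r"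
  proof
    fix r assume "r \<in> lab ` C"
    then obtain c where c: "c \<in> C" and r: "r = lab c" by blast
    obtain b where b: "\<forall>x\<in>X. \<exists>t<b. agree (ret c + n) (sh t x) c"
      using bounded_visits[OF C_in_X[OF c], of "ret c + n"] by blast
    have "\<exists>t<b. sh t x \<in> C \<and> lab (sh t x) = r" if "x \<in> X" for x
    proof -
      obtain t where "t < b" "agree (ret c + n) (sh t x) c" using bspec[OF b \<open>x \<in> X\<close>] by blast
      then have t: "t < b" "agree (ret c + n) c (sh t x)" by (simp_all add: agree_sym)
      then have "sh t x \<in> C" using C_agree[OF c sh_in_X[OF \<open>x \<in> X\<close>]] agree_mono[OF t(2), of n] by simp
      moreover have "lab (sh t x) = lab c" using lab_agree[OF C_in_X[OF c] sh_in_X[OF \<open>x \<in> X\<close>] t(2)] .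
      ultimately show ?thesis using t(1) r by blast
    qed
    then have "\<forall>x\<in>X. \<exists>t<b. sh t x \<in> C \<and> lab (sh t x) = r" by (rule ballI)
    then show "\<exists>b. \<forall>x\<in>X. \<exists>t<b. sh t x \<in> C \<and> lab (sh t x) = r" by (rule exI)
  qed
  from bchoice[OF this] obtain f
    where f: "\<forall>r\<in>lab ` C. \<forall>x\<in>X. \<exists>t<f r. sh t x \<in> C \<and> lab (sh t x) = r" ..
  define b where "b = Max (f ` lab ` C)"
  have b: "f r \<le> b" if "r \<in> lab ` C" for r unfolding b_def using that finite_lab by simp
  obtain k0 where k0: "\<forall>k\<ge>k0. \<forall>z\<in>(\<theta> ^^ k) ` C. \<forall>i. 0 < i \<and> i \<le> b \<longrightarrow> sh i z \<notin> (\<theta> ^^ k) ` C"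
    using late_returns[of b] ..
  \<comment> \<open>A positive \<open>k\<close> is required so that its multiples can serve as
    telescoping levels.\<close>
  define k where "k = max 1 k0"
  have "\<exists>c\<in>C. lab c = r \<and> lab ((D ^^ k) c) = lab d" if r: "r \<in> lab ` C" and d: "d \<in> C" for r d
  proof -
    let ?z = "(\<theta> ^^ k) d"
    have z: "?z \<in> C" using \<theta>k_in_C d by blast
    obtain t where t: "t < f r" "sh t ?z \<in> C" "lab (sh t ?z) = r"
      using bspec[OF bspec[OF f r] C_in_X[OF z]] by blast
    have "(D ^^ k) (sh t ?z) = (D ^^ k) ?z"
    proof (rule Dk_sh[OF z t(2)])
      show "sh i ?z \<notin> (\<theta> ^^ k) ` C" if "0 < i" "i \<le> t" for i
      proof -
        have "i \<le> b" using that t(1) b[OF r] by linarith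
        moreover have "k0 \<le> k" by (simp add: k_def)
        ultimately show ?thesis using k0 that(1) d by blast
      qed
    qed
    then have "(D ^^ k) (sh t ?z) = d" using Dk_\<theta>k d by simp
    then show ?thesis using t by (intro bexI[of _ "sh t ?z"] conjI) simp_all
  qed
  then have "\<forall>r\<in>lab ` C. \<forall>r'\<in>lab ` C. \<exists>c\<in>C. lab c = r \<and> lab ((D ^^ k) c) = r'"
    by (simp only: ball_simps) simp
  moreover have "1 \<le> k" by (simp add: k_def)
  ultimately show ?thesis by (intro exI[of _ k] conjI)
qed

section \<open>The Bratteli diagram\<close>

definition rep :: "'a list \<Rightarrow> nat \<Rightarrow> 'a" where
  "rep r = (SOME c. c \<in> C \<and> lab c = r)"

text \<open>An edge of level \<open>k + 1\<close> is a pair of a return word \<open>r\<close>, its range, and a position in the tower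
  over \<open>r\<close>: any floor if \<open>k = 0\<close>, and otherwise a floor that lies in \<open>C\<close>.\<close>

definition pos :: "nat \<Rightarrow> 'a list \<Rightarrow> nat set" where
  "pos k r = (if k = 0 then {..<length r} else {t. t < length (W r) \<and> sh t (\<theta> (rep r)) \<in> C})"

text \<open>The source of the edge at position \<open>t\<close>. By
  \<open>level_visit_transfer\<close> the choice of the representative does not matter.\<close>

definition low :: "'a list \<Rightarrow> nat \<Rightarrow> 'a list" where
  "low r t = lab (sh t (\<theta> (rep r)))"

definition height :: "nat \<Rightarrow> 'a list \<Rightarrow> nat" where
  "height k r = (if k = 0 then length r else length (W r))"

text \<open>For a position \<open>t\<close>, the gap to the next position in the tower, or to its
  top if \<open>t\<close> is the last one.\<close>

definition width :: "nat \<Rightarrow> 'a list \<Rightarrow> nat \<Rightarrow> nat" where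
  "width k r t = (if k = 0 then 1 else length (low r t))"

lemma rep: "r \<in> lab ` C \<Longrightarrow> rep r \<in> C \<and> lab (rep r) = r"
  unfolding rep_def by (rule someI_ex[where P = "\<lambda>c. c \<in> C \<and> lab c = r"]) blast

text \<open>This is why the transition rule depends on return words only. \<open>\<theta> c\<close>
  and \<open>\<theta> c'\<close> agree on \<open>l\<close> letters because the labels agree, and on
  \<open>n\<close> more because both are in \<open>C\<close> at time \<open>l\<close>. A visit at
  \<open>t < l\<close> returns by time \<open>l\<close>, so these letters determine it and its
  label.\<close>

lemma level_visit_transfer:
  assumes c: "c \<in> C" "c' \<in> C" and eq: "lab c = lab c'"
    and t: "t < length (W (lab c))" and visit: "sh t (\<theta> c) \<in> C"
  shows "sh t (\<theta> c') \<in> C" "lab (sh t (\<theta> c')) = lab (sh t (\<theta> c))"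
proof -
  define l where "l = length (W (lab c))"
  have "agree (ret c) c c'" using eq by (metis agree_factor lab_def length_lab)
  from agree_\<theta>_strong[OF this] have "agree l (\<theta> c) (\<theta> c')"
    by (rule agree_mono) (simp add: l_def lab_def)
  moreover have "agree n (sh l (\<theta> c)) (sh l (\<theta> c'))"
  proof (rule agree_in_C)
    show "sh l (\<theta> c) \<in> C" "sh l (\<theta> c') \<in> C"
      using level.g_step[OF c(1)] level.g_step[OF c(2)] nxt_in_C C_in_X \<theta>_in_C c eq
      by (simp_all add: l_def)
  qed
  ultimately have "agree (l + n) (\<theta> c) (\<theta> c')" by (rule agree_add)
  moreover have "t + ret (sh t (\<theta> c)) \<le> l" using return_before_level[OF c(1) t] by (simp add: l_def)
  ultimately have "agree (t + (ret (sh t (\<theta> c)) + n)) (\<theta> c) (\<theta> c')"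
    by (elim agree_mono) simp
  then have agr: "agree (ret (sh t (\<theta> c)) + n) (sh t (\<theta> c)) (sh t (\<theta> c'))"
    by (rule agree_sh)
  have X: "sh t (\<theta> c) \<in> X" "sh t (\<theta> c') \<in> X" using c \<theta>_in_C C_in_X sh_in_X by blast+
  show "sh t (\<theta> c') \<in> C" using C_agree[OF visit X(2)] agree_mono[OF agr, of n] by simp
  show "lab (sh t (\<theta> c')) = lab (sh t (\<theta> c))" using lab_agree[OF X agr] .
qed

lemma level_visit:
  assumes "c \<in> C" "t < length (W (lab c))" "sh t (\<theta> c) \<in> C"
  shows "t \<in> pos (Suc k) (lab c)" "low (lab c) t = lab (sh t (\<theta> c))"
  using level_visit_transfer[OF assms(1) _ _ assms(2,3), of "rep (lab c)"] rep[of "lab c"] assms(1,2)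
  by (simp_all add: pos_def low_def)

lemma level_visitD:
  assumes "c \<in> C" "t \<in> pos (Suc k) (lab c)"
  shows "sh t (\<theta> c) \<in> C" "t < length (W (lab c))"
  using level_visit_transfer(1)[of "rep (lab c)" c t] rep[of "lab c"] assms by (auto simp: pos_def)

lemma pos_less: "t \<in> pos k r \<Longrightarrow> t < height k r"
  by (auto simp: pos_def height_def split: if_splits)

lemma zero_in_pos:
  assumes "r \<in> lab ` C" shows "0 \<in> pos k r"
proof -
  have "0 < length r" "0 < length (W r)" "\<theta> (rep r) \<in> C"
    using floor.h_pos[of "rep r"] level.h_pos[of "rep r"] rep[OF assms] \<theta>_in_C by auto
  then show ?thesis by (simp add: pos_def)
qed

lemma width_pos:
  assumes "r \<in> lab ` C" shows "0 < width k r t"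
proof -
  have "sh t (\<theta> (rep r)) \<in> X" using rep[OF assms] \<theta>_in_C C_in_X sh_in_X by blast
  then show ?thesis using ret_pos by (simp add: width_def low_def)
qed

lemma width_le:
  assumes "r \<in> lab ` C" "t \<in> pos k r" shows "t + width k r t \<le> height k r"
  using assms return_before_level[of "rep r" t] rep[OF assms(1)]
  by (auto simp: pos_def width_def height_def low_def Suc_le_eq split: if_splits)

lemma next_in_pos:
  assumes "r \<in> lab ` C" "t \<in> pos k r" "t + width k r t < height k r"
  shows "t + width k r t \<in> pos k r"
proof (cases "k = 0")
  case False
  have "nxt (sh t (\<theta> (rep r))) \<in> C" using assms(2) False nxt_in_C C_in_X by (simp add: pos_def)
  then show ?thesis
    using assms(3) False by (simp add: pos_def width_def height_def low_def nxt_def sh_sh add.commute)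
qed (use assms in \<open>auto simp: pos_def width_def height_def\<close>)

lemma next_pos_le:
  assumes "r \<in> lab ` C" "t \<in> pos k r" "t' \<in> pos k r" "t < t'"
  shows "t + width k r t \<le> t'"
proof (cases "k = 0")
  case False
  have "sh (t' - t) (sh t (\<theta> (rep r))) \<in> C" using assms(3,4) False by (simp add: pos_def sh_sh)
  then have "ret (sh t (\<theta> (rep r))) \<le> t' - t" using ret_le assms(4) by simp
  then show ?thesis using assms(4) False by (simp add: width_def low_def)
qed (use assms in \<open>auto simp: width_def\<close>)

section \<open>The diagram, coded by natural numbers, and its structural properties\<close>

lemma low_in_lab: "t \<in> pos (Suc k) r \<Longrightarrow> low r t \<in> lab ` C"
  by (auto simp: pos_def low_def)

definition edge_word :: "nat \<Rightarrow> 'a list" where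
  "edge_word e = fst (from_nat e :: 'a list \<times> nat)"

definition edge_pos :: "nat \<Rightarrow> nat" where
  "edge_pos e = snd (from_nat e :: 'a list \<times> nat)"

text \<open>Edges are numbered from level 1 but \<open>pos\<close> counts from 0, hence
  \<open>k - 1\<close>.\<close>

definition edge_set :: "nat \<Rightarrow> nat set" where
  "edge_set k = {to_nat (r, t) | r t. r \<in> lab ` C \<and> t \<in> pos (k - 1) r}"

definition B :: "(nat, nat) ordered_bratteli" where
  "B = \<lparr> verts = (\<lambda>k. if k = 0 then {0} else to_nat ` lab ` C),
        edges = edge_set,
        src = (\<lambda>k e. if k = 1 then 0 else to_nat (low (edge_word e) (edge_pos e))),
        rng = (\<lambda>k e. to_nat (edge_word e)),
        edge_ord = (\<lambda>k a. {(e, f). e \<in> edge_set k \<and> f \<in> edge_set k \<and>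
          to_nat (edge_word e) = a \<and> to_nat (edge_word f) = a \<and> edge_pos e \<le> edge_pos f}) \<rparr>"

lemma edge_word_pos [simp]: "edge_word (to_nat (r, t)) = r" "edge_pos (to_nat (r, t)) = t"
  by (simp_all add: edge_word_def edge_pos_def)

lemma edge_eta: "e \<in> edge_set k \<Longrightarrow> to_nat (edge_word e, edge_pos e) = e"
  by (auto simp: edge_set_def)

lemma B_simps:
  "verts B 0 = {0}" "verts B (Suc k) = to_nat ` lab ` C" "edges B k = edge_set k"
  "src B (Suc 0) e = 0" "src B (Suc (Suc k)) e = to_nat (low (edge_word e) (edge_pos e))"
  "rng B k e = to_nat (edge_word e)"
  by (simp_all add: B_def)

lemma mem_edge_set: "to_nat (r, t) \<in> edge_set (Suc k) \<longleftrightarrow> r \<in> lab ` C \<and> t \<in> pos k r"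
  by (auto simp: edge_set_def)

lemma edges_into_B: "edges_into B (Suc k) (to_nat r) = {to_nat (r, t) | t. r \<in> lab ` C \<and> t \<in> pos k r}"
  by (auto simp: edges_into_def B_simps edge_set_def)

lemma edge_ord_B:
  "(to_nat (r, t), to_nat (r, t')) \<in> edge_ord B (Suc k) (to_nat r) \<longleftrightarrow>
     r \<in> lab ` C \<and> t \<in> pos k r \<and> t' \<in> pos k r \<and> t \<le> t'"
  by (auto simp: B_def mem_edge_set)

text \<open>By \<open>next_in_pos\<close> and \<open>next_pos_le\<close>,
  \<open>t + width k r t\<close> is the next position unless it is already the height of the
  tower.\<close>

lemma max_edge_B:
  assumes "r \<in> lab ` C" "t \<in> pos k r"
  shows "max_edge B (Suc k) (to_nat (r, t)) \<longleftrightarrow> t + width k r t = height k r"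
proof -
  have "max_edge B (Suc k) (to_nat (r, t)) \<longleftrightarrow> (\<forall>t'\<in>pos k r. t' \<le> t)"
    using assms by (auto simp: max_edge_def B_simps mem_edge_set edges_into_B edge_ord_B)
  also have "\<dots> \<longleftrightarrow> t + width k r t = height k r"
  proof
    assume *: "\<forall>t'\<in>pos k r. t' \<le> t"
    show "t + width k r t = height k r"
    proof (rule ccontr)
      assume "t + width k r t \<noteq> height k r"
      then have "t + width k r t \<in> pos k r" using next_in_pos width_le assms le_neq_implies_less by blast
      then show False using * width_pos[OF assms(1), of k t] by fastforce
    qed
  next
    assume *: "t + width k r t = height k r"
    show "\<forall>t'\<in>pos k r. t' \<le> t"
      using next_pos_le[OF assms] pos_less * by (metis linorder_not_le)
  qed
  finally show ?thesis .
qed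

lemma min_edge_B:
  assumes "r \<in> lab ` C" "t \<in> pos k r"
  shows "min_edge B (Suc k) (to_nat (r, t)) \<longleftrightarrow> t = 0"
  using assms zero_in_pos[OF assms(1), of k]
  by (auto simp: min_edge_def B_simps mem_edge_set edges_into_B edge_ord_B)

lemma min_edge_eq:
  fixes r :: "'a list"
  assumes "min_edge B (Suc k) e" "rng B (Suc k) e = to_nat r" shows "e = to_nat (r, 0 :: nat)"
proof -
  obtain r' t where e: "e = to_nat (r', t)" "r' \<in> lab ` C" "t \<in> pos k r'"
    using assms(1) by (auto simp: min_edge_def B_simps edge_set_def)
  then show ?thesis using assms min_edge_B by (simp add: B_simps)
qed

lemma succ_edge_B:
  assumes r: "r \<in> lab ` C" "t \<in> pos k r" and less: "t + width k r t < height k r"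
  shows "succ_edge B (Suc k) (to_nat (r, t)) = to_nat (r, t + width k r t)"
proof -
  let ?t = "t + width k r t"
  let ?P = "\<lambda>f. f \<in> edges_into B (Suc k) (to_nat r) \<and> f \<noteq> to_nat (r, t) \<and>
    (to_nat (r, t), f) \<in> edge_ord B (Suc k) (to_nat r) \<and>
    (\<forall>g\<in>edges_into B (Suc k) (to_nat r).
       g \<noteq> to_nat (r, t) \<and> (to_nat (r, t), g) \<in> edge_ord B (Suc k) (to_nat r) \<longrightarrow>
       (f, g) \<in> edge_ord B (Suc k) (to_nat r))"
  have P: "?P (to_nat (r, ?t))"
    using r next_in_pos[OF r less] width_pos[OF r(1), of k t] next_pos_le[OF r]
    by (auto simp: edges_into_B edge_ord_B)
  have "f = to_nat (r, ?t)" if f: "?P f" for f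
  proof -
    obtain t' where t': "f = to_nat (r, t')" "t' \<in> pos k r" using f by (auto simp: edges_into_B)
    have "(f, to_nat (r, ?t)) \<in> edge_ord B (Suc k) (to_nat r)"
      "(to_nat (r, ?t), f) \<in> edge_ord B (Suc k) (to_nat r)"
      using f P by blast+
    then show ?thesis by (simp add: t' edge_ord_B)
  qed
  with P have "(THE f. ?P f) = to_nat (r, ?t)" by (rule the_equality[where P = ?P])
  then show ?thesis by (simp add: succ_edge_def Let_def B_simps(6))
qed

lemma finite_edge_set: "finite (edge_set (Suc k))"
proof -
  have "edge_set (Suc k) \<subseteq> to_nat ` (SIGMA r : lab ` C. {..<height k r})"
    using pos_less by (auto simp: edge_set_def)
  then show ?thesis by (rule finite_subset) (use finite_lab in auto)
qed

text \<open>A point \<open>c\<close> with label \<open>r\<close> lies on a floor of the tower over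
  \<open>\<theta> (D c)\<close>; this floor is the edge sought.\<close>

lemma ex_edge_from: "r \<in> lab ` C \<Longrightarrow> \<exists>r' t. r' \<in> lab ` C \<and> t \<in> pos (Suc k) r' \<and> low r' t = r"
proof -
  assume "r \<in> lab ` C"
  then obtain c where c: "c \<in> C" "r = lab c" by blast
  then show ?thesis
    using level_visit[OF D_in_C dt_less, of c] level_of[OF c(1)] D_in_C[OF c(1)] by auto
qed

lemma bratteli_diagram_B: "bratteli_diagram B"
  unfolding bratteli_diagram_def
proof (intro conjI allI ballI impI)
  show "\<exists>v0. verts B 0 = {v0}" by (simp add: B_simps)
  show "finite (verts B k)" for k using finite_lab by (cases k) (auto simp: B_simps)
  show "finite (edges B k)" if "k \<ge> 1" for k
    using that finite_edge_set[of "k - 1"] by (simp add: B_simps)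
  show "src B k e \<in> verts B (k - 1)" if "k \<ge> 1" "e \<in> edges B k" for k e
  proof -
    obtain j where k: "k = Suc j" using \<open>k \<ge> 1\<close> by (cases k) auto
    then show ?thesis
      using \<open>e \<in> edges B k\<close> low_in_lab by (cases j) (auto simp: B_simps edge_set_def)
  qed
  show "rng B k e \<in> verts B k" if "k \<ge> 1" "e \<in> edges B k" for k e
    using that by (cases k) (auto simp: B_simps edge_set_def)
  show "\<exists>e\<in>edges B (k + 1). src B (k + 1) e = v" if "v \<in> verts B k" for k v
  proof (cases k)
    case 0
    have "to_nat (lab y, 0 :: nat) \<in> edge_set (Suc 0)"
      using y_in_C zero_in_pos by (simp add: mem_edge_set)
    then show ?thesis using that 0 by (auto simp: B_simps)
  next
    case (Suc j)
    then obtain r where "r \<in> lab ` C" "v = to_nat r" using \<open>v \<in> verts B k\<close> by (auto simp: B_simps)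
    moreover from this obtain r' t where "r' \<in> lab ` C" "t \<in> pos (Suc j) r'" "low r' t = r"
      using ex_edge_from by blast
    ultimately show ?thesis
      using Suc by (intro bexI[of _ "to_nat (r', t)"]) (auto simp: B_simps mem_edge_set)
  qed
  show "\<exists>e\<in>edges B k. rng B k e = v" if "k \<ge> 1" "v \<in> verts B k" for k v
  proof -
    obtain j where k: "k = Suc j" using \<open>k \<ge> 1\<close> by (cases k) auto
    then obtain r where "r \<in> lab ` C" "v = to_nat r" using \<open>v \<in> verts B k\<close> by (auto simp: B_simps)
    then show ?thesis
      using k zero_in_pos by (intro bexI[of _ "to_nat (r, 0 :: nat)"]) (auto simp: B_simps mem_edge_set)
  qed
qed

lemma ordered_diagram_B: "ordered_diagram B"
  unfolding ordered_diagram_def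
proof (intro conjI allI impI ballI bratteli_diagram_B)
  fix k a
  let ?R = "edge_ord B k a"
  have R: "?R = {(e, f). e \<in> edges_into B k a \<and> f \<in> edges_into B k a \<and> edge_pos e \<le> edge_pos f}"
    by (auto simp: B_def edges_into_def)
  have inj: "e = f" if "e \<in> edges_into B k a" "f \<in> edges_into B k a" "edge_pos e = edge_pos f" for e f
  proof -
    have "to_nat (edge_word e) = to_nat (edge_word f)" "e \<in> edge_set k" "f \<in> edge_set k"
      using that(1,2) by (simp_all add: edges_into_def B_simps)
    then show ?thesis using that(3) edge_eta by (metis to_nat_split)
  qed
  show "linear_order_on (edges_into B k a) ?R"
    unfolding linear_order_on_def partial_order_on_def preorder_on_def R
    by (auto simp: refl_on_def trans_def antisym_def total_on_def intro: inj)
qed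

lemma stationary_B: "stationary B"
proof -
  \<comment> \<open>\<open>pos\<close> distinguishes only the argument 0 from all others, and 0
    belongs to edges of level 1.\<close>
  have E: "edge_set k = edge_set 2" if "k \<ge> 2" for k
    using that by (auto simp: edge_set_def pos_def)
  have verts: "verts B k = to_nat ` lab ` C" if "k \<ge> 1" for k using that by (simp add: B_def)
  have src: "src B k = src B 2" if "k \<ge> 2" for k using that by (simp add: B_def)
  have rng: "rng B k = rng B 2" for k by (simp add: B_def)
  have ord: "edge_ord B k = edge_ord B 2" if "k \<ge> 2" for k by (simp add: B_def E[OF that])
  show ?thesis
    unfolding stationary_def
  proof (rule exI[of _ "to_nat ` lab ` C"], rule exI[of _ "edge_set 2"], rule exI[of _ "src B 2"],
      rule exI[of _ "rng B 2"], rule exI[of _ "edge_ord B 2"], rule exI[of _ "\<lambda>_. id"],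
      rule exI[of _ "\<lambda>_. id"], intro conjI allI impI ballI)
    show "bij_betw id (verts B k) (to_nat ` lab ` C)" if "k \<ge> 1" for k by (simp add: verts[OF that])
    show "bij_betw id (edges B k) (edge_set 2)" if "k \<ge> 2" for k by (simp add: B_simps(3) E[OF that])
    show "src B 2 (id e) = id (src B k e)" if "k \<ge> 2" for k e by (simp add: src[OF that])
    show "rng B 2 (id e) = id (rng B k e)" for k e by (simp add: rng[of k])
    show "(e, f) \<in> edge_ord B k a \<longleftrightarrow> (id e, id f) \<in> edge_ord B 2 (id a)" if "k \<ge> 2" for k a e f
      by (simp add: ord[OF that])
  qed
qed

text \<open>The points \<open>c\<close>, \<open>D c\<close>, ..., \<open>(D ^^ k) c\<close> spell
  out a path. It can start at any level \<open>m \<ge> 1\<close>, since all its edges then have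
  level at least 2, where the rule is the same.\<close>

lemma telescope_edge:
  assumes c: "c \<in> C" and k: "k \<ge> 1" "m \<ge> 1"
  shows "\<exists>p \<in> finite_paths B m (m + k). src B (m + 1) (hd p) = to_nat (lab c) \<and>
    rng B (m + k) (last p) = to_nat (lab ((D ^^ k) c))"
proof -
  define p where "p = map (\<lambda>i. to_nat (lab ((D ^^ Suc i) c), dt ((D ^^ i) c))) [0..<k]"
  have nth: "p ! i = to_nat (lab ((D ^^ Suc i) c), dt ((D ^^ i) c))" if "i < k" for i
    using that by (simp add: p_def)
  have len: "length p = k" by (simp add: p_def)
  obtain m' where m: "m = Suc m'" using k(2) by (cases m) auto
  have visit: "dt ((D ^^ i) c) \<in> pos (Suc j) (lab ((D ^^ Suc i) c))"
    "low (lab ((D ^^ Suc i) c)) (dt ((D ^^ i) c)) = lab ((D ^^ i) c)" for i j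
    using level_visit[OF D_in_C dt_less, of "(D ^^ i) c"] level_of[of "(D ^^ i) c"] Dk_in_C[OF c, of i] by auto
  have "p \<in> finite_paths B m (m + k)"
    unfolding finite_paths_def
  proof (intro CollectI conjI allI impI)
    show "p ! i \<in> edges B (m + i + 1)" if "i < length p" for i
      using that visit[of i] Dk_in_C[OF c, of "Suc i"] by (auto simp: nth len m B_simps mem_edge_set)
    show "src B (m + i + 2) (p ! (i + 1)) = rng B (m + i + 1) (p ! i)" if "i + 1 < length p" for i
      using that visit[of "i + 1"] by (simp add: nth len m B_simps)
  qed (simp add: len)
  moreover have "hd p = p ! 0" "last p = p ! (k - 1)"
  proof -
    have "p \<noteq> []" using k(1) len by auto
    then show "hd p = p ! 0" "last p = p ! (k - 1)" by (simp_all add: hd_conv_nth last_conv_nth len)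
  qed
  moreover have "src B (m + 1) (p ! 0) = to_nat (lab c)" using k(1) visit(2)[of 0] by (simp add: nth m B_simps)
  moreover have "rng B (m + k) (p ! (k - 1)) = to_nat (lab ((D ^^ k) c))" using k(1) by (simp add: nth B_simps)
  ultimately show ?thesis by (intro bexI[of _ p]) simp_all
qed

lemma simple_diagram_B: "simple_diagram B"
proof -
  obtain k where k: "k \<ge> 1"
    and conn: "\<forall>r\<in>lab ` C. \<forall>r'\<in>lab ` C. \<exists>c\<in>C. lab c = r \<and> lab ((D ^^ k) c) = r'"
    using lab_connected by blast
  have "\<exists>e\<in>finite_paths B (k * m) (k * (m + 1)).
      src B (k * m + 1) (hd e) = v \<and> rng B (k * (m + 1)) (last e) = w"
    if m: "m \<ge> 1" "v \<in> verts B (k * m)" "w \<in> verts B (k * (m + 1))" for m v w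
  proof -
    have km: "k * m \<ge> 1" "k * (m + 1) \<ge> 1" using k m(1) by auto
    then obtain a b where "k * m = Suc a" "k * (m + 1) = Suc b" by (metis Suc_le_D One_nat_def)
    then obtain r r' where r: "r \<in> lab ` C" "v = to_nat r" "r' \<in> lab ` C" "w = to_nat r'"
      using m(2,3) by (auto simp: B_simps)
    obtain c where c: "c \<in> C" "lab c = r" "lab ((D ^^ k) c) = r'"
      using bspec[OF bspec[OF conn r(1)] r(3)] by blast
    have "k * (m + 1) = k * m + k" by simp
    then show ?thesis using telescope_edge[OF c(1) k km(1)] c(2,3) r(2,4) by (simp only:)
  qed
  moreover have "strict_mono (\<lambda>m. k * m)" using k by (auto simp: strict_mono_def)
  ultimately show ?thesis
    unfolding simple_diagram_def Let_def telescope_def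
    by (intro exI[of _ "\<lambda>m. k * m"] conjI) simp_all
qed

section \<open>Points as paths\<close>

definition lev :: "(nat \<Rightarrow> 'a) \<Rightarrow> nat \<Rightarrow> nat \<Rightarrow> 'a" where
  "lev x k = (D ^^ k) (floor.base x)"

definition off :: "(nat \<Rightarrow> 'a) \<Rightarrow> nat \<Rightarrow> nat" where
  "off x k = (case k of 0 \<Rightarrow> floor.hgt x | Suc j \<Rightarrow> dt (lev x j))"

text \<open>The value at 0 makes \<open>path x\<close> extensional on \<open>{1..}\<close>, as
  \<open>path_space\<close> demands.\<close>

definition path :: "(nat \<Rightarrow> 'a) \<Rightarrow> nat \<Rightarrow> nat" where
  "path x k = (if k = 0 then undefined else to_nat (lab (lev x (k - 1)), off x (k - 1)))"

lemma path_Suc [simp]: "path x (Suc k) = to_nat (lab (lev x k), off x k)"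
  by (simp add: path_def)

lemma off_0 [simp]: "off x 0 = floor.hgt x" and off_Suc [simp]: "off x (Suc k) = dt (lev x k)"
  by (simp_all add: off_def)

lemma lev_0: "lev x 0 = floor.base x" and lev_Suc: "lev x (Suc k) = D (lev x k)"
  by (simp_all add: lev_def)

lemma lev_add: "lev x (k + i) = (D ^^ i) (lev x k)"
  unfolding lev_def add.commute[of k i] funpow_add by simp

lemma lev_in_C: "x \<in> X \<Longrightarrow> lev x k \<in> C"
  unfolding lev_def by (intro Dk_in_C floor.base_in_C)

lemma off_in_pos:
  assumes "x \<in> X" shows "off x k \<in> pos k (lab (lev x k))"
proof (cases k)
  case 0
  then show ?thesis using floor.hgt_less[OF assms] by (simp add: pos_def lev_0)
next
  case (Suc j)
  have c: "lev x j \<in> C" using lev_in_C assms by blast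
  show ?thesis using level_visit(1)[OF D_in_C[OF c] dt_less[OF c]] level_of[OF c] c
    by (simp add: Suc lev_Suc)
qed

lemma low_off:
  assumes "x \<in> X" shows "low (lab (lev x (Suc k))) (off x (Suc k)) = lab (lev x k)"
proof -
  have c: "lev x k \<in> C" using lev_in_C assms by blast
  show ?thesis using level_visit(2)[OF D_in_C[OF c] dt_less[OF c]] level_of[OF c] c by (simp add: lev_Suc)
qed

lemma lab_lev: "x \<in> X \<Longrightarrow> lab (lev x k) \<in> lab ` C"
  using lev_in_C by blast

lemma path_in_path_space:
  assumes "x \<in> X" shows "path x \<in> path_space B"
  unfolding path_space_def
proof (intro CollectI conjI PiE_I allI impI)
  show "path x k \<in> edges B k" if "k \<in> {1..}" for k
    using that lab_lev[OF assms] off_in_pos[OF assms] by (cases k) (simp_all add: B_simps mem_edge_set)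
  show "path x k = undefined" if "k \<notin> {1..}" for k
    using that by (simp add: path_def)
  show "src B (k + 1) (path x (k + 1)) = rng B k (path x k)" if "1 \<le> k" for k
  proof -
    obtain j where k: "k = Suc j" using \<open>1 \<le> k\<close> by (cases k) auto
    show ?thesis using low_off[OF assms, of j] by (simp add: k B_simps del: off_Suc)
  qed
qed

lemma path_injective:
  assumes "x \<in> X" "x' \<in> X" "path x = path x'" shows "x = x'"
proof -
  have eq: "lab (lev x k) = lab (lev x' k)" "off x k = off x' k" for k
    using fun_cong[OF assms(3), of "Suc k"] by simp_all
  have "floor.base x = floor.base x'"
  proof (rule same_path_eq)
    show "floor.base x \<in> C" "floor.base x' \<in> C" using floor.base_in_C assms by auto
    show "lab ((D ^^ i) (floor.base x)) = lab ((D ^^ i) (floor.base x'))" for i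
      using eq(1)[of i] by (simp add: lev_def)
    show "dt ((D ^^ i) (floor.base x)) = dt ((D ^^ i) (floor.base x'))" for i
      using eq(2)[of "Suc i"] by (simp add: lev_def)
  qed
  then show ?thesis using floor.floor_of[OF assms(1)] floor.floor_of[OF assms(2)] eq(2)[of 0]
    by (metis off_0)
qed

subsection \<open>Every path is realized\<close>

lemma closedin_lev:
  assumes "closedin XT Z" "Z \<subseteq> C" shows "closedin XT {x \<in> X. lev x k \<in> Z}"
proof -
  have "closedin XT {c \<in> C. (D ^^ k) c \<in> Z} \<and> {c \<in> C. (D ^^ k) c \<in> Z} \<subseteq> C"
  proof (induction k)
    case 0
    have "{c \<in> C. (D ^^ 0) c \<in> Z} = Z" using assms(2) by auto
    then show ?case using assms by simp
  next
    case (Suc k)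
    let ?Y = "{c \<in> C. (D ^^ k) c \<in> Z}"
    have "closedin XT {x \<in> X. D x \<in> ?Y}" using Suc by (intro level.closedin_base_hgt) auto
    then have "closedin XT (C \<inter> {x \<in> X. D x \<in> ?Y})" using closedin_C by (intro closedin_Int)
    moreover have "C \<inter> {x \<in> X. D x \<in> ?Y} = {c \<in> C. (D ^^ Suc k) c \<in> Z}"
      using D_in_C C_in_X by (auto simp: funpow_swap1)
    ultimately show ?case by auto
  qed
  then have "closedin XT {x \<in> X. floor.base x \<in> {c \<in> C. (D ^^ k) c \<in> Z}}"
    by (intro floor.closedin_base_hgt) auto
  moreover have "{x \<in> X. floor.base x \<in> {c \<in> C. (D ^^ k) c \<in> Z}} = {x \<in> X. lev x k \<in> Z}"
    using floor.base_in_C by (auto simp: lev_def)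
  ultimately show ?thesis by simp
qed

text \<open>Since \<open>P\<close> is arbitrary, these sets are in fact clopen. This yields both the
  closed sets of the compactness argument and the continuity of \<open>path\<close>.\<close>

lemma closedin_path: "closedin XT {x \<in> X. P (path x (Suc k))}"
proof (cases k)
  case 0
  have "closedin XT {x \<in> X. floor.base x \<in> {c \<in> C. P (to_nat (lab c, floor.hgt x))}}"
    by (intro floor.closedin_base_hgt closedin_lab) auto
  moreover have "{x \<in> X. floor.base x \<in> {c \<in> C. P (to_nat (lab c, floor.hgt x))}} = {x \<in> X. P (path x (Suc k))}"
    using floor.base_in_C by (auto simp: 0 lev_0)
  ultimately show ?thesis by simp
next
  case (Suc j)
  let ?Z = "C \<inter> {x \<in> X. D x \<in> {d \<in> C. P (to_nat (lab d, dt x))}}"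
  have "closedin XT ?Z"
    by (intro closedin_Int closedin_C level.closedin_base_hgt closedin_lab) auto
  then have "closedin XT {x \<in> X. lev x j \<in> ?Z}" by (rule closedin_lev) auto
  moreover have "{x \<in> X. lev x j \<in> ?Z} = {x \<in> X. P (path x (Suc k))}"
    using lev_in_C C_in_X D_in_C by (auto simp: Suc lev_Suc)
  ultimately show ?thesis by simp
qed

text \<open>Any \<open>c\<close> with the right label may be prescribed as base point of level
  \<open>k\<close>. The edge into that level then fixes the base point
  \<open>sh t (\<theta> c)\<close> one level below, and so on down to a floor over \<open>C\<close>;
  hence the induction over all \<open>c\<close>.\<close>

lemma path_prefix_realized:
  assumes z: "z \<in> path_space B" and c: "c \<in> C" "rng B (Suc k) (z (Suc k)) = to_nat (lab c)"
  shows "\<exists>x\<in>X. lev x k = c \<and> (\<forall>i\<le>k. path x (Suc i) = z (Suc i))"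
  using c
proof (induction k arbitrary: c)
  case 0
  have "z (Suc 0) \<in> edge_set (Suc 0)" using z by (auto simp: path_space_def B_simps)
  then obtain r t where rt: "z (Suc 0) = to_nat (r, t)" "r \<in> lab ` C" "t \<in> pos 0 r"
    by (auto simp: edge_set_def)
  then have "r = lab c" using 0(2) by (simp add: B_simps)
  then have t: "t < length (lab c)" using rt(3) by (simp add: pos_def)
  have "path (sh t c) (Suc 0) = z (Suc 0)"
    using floor.base_eq[OF 0(1) t] floor.hgt_eq[OF 0(1) t] rt(1) \<open>r = lab c\<close> by (simp add: lev_0)
  then show ?case
    using floor.base_eq[OF 0(1) t] sh_in_X C_in_X[OF 0(1)] by (intro bexI[of _ "sh t c"]) (auto simp: lev_0)
next
  case (Suc k)
  have "z (Suc (Suc k)) \<in> edge_set (Suc (Suc k))" using z by (auto simp: path_space_def B_simps)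
  then obtain r t where rt: "z (Suc (Suc k)) = to_nat (r, t)" "r \<in> lab ` C" "t \<in> pos (Suc k) r"
    by (auto simp: edge_set_def)
  then have r: "r = lab c" using Suc.prems(2) by (simp add: B_simps)
  define d where "d = sh t (\<theta> c)"
  have t: "d \<in> C" "t < length (W (lab c))" using level_visitD[OF Suc.prems(1)] rt(3) r by (auto simp: d_def)
  have D: "D d = c" "dt d = t" using level.base_eq level.hgt_eq Suc.prems(1) t(2) by (simp_all add: d_def)
  have "src B (Suc (Suc k)) (z (Suc (Suc k))) = rng B (Suc k) (z (Suc k))"
    using z by (auto simp: path_space_def)
  then have "rng B (Suc k) (z (Suc k)) = to_nat (lab d)"
    using level_visit(2)[OF Suc.prems(1) t(2)] t(1) by (simp add: rt(1) B_simps r d_def)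
  then obtain x where x: "x \<in> X" "lev x k = d" "\<forall>i\<le>k. path x (Suc i) = z (Suc i)"
    using Suc.IH t(1) by blast
  have "lev x (Suc k) = c" "path x (Suc (Suc k)) = z (Suc (Suc k))"
    using x(2) D rt(1) r by (simp_all add: lev_Suc)
  then show ?case using x by (intro bexI[of _ x]) (auto simp: le_Suc_eq)
qed

lemma path_surjective:
  assumes z: "z \<in> path_space B" shows "\<exists>x\<in>X. path x = z"
proof -
  define K where "K = (\<lambda>k. {x \<in> X. \<forall>i\<le>k. path x (Suc i) = z (Suc i)})"
  have "closedin XT (K k)" for k
  proof -
    have "K k = (\<Inter>i\<in>{..k}. {x \<in> X. path x (Suc i) = z (Suc i)})" by (auto simp: K_def)
    moreover have "closedin XT (\<Inter>i\<in>{..k}. {x \<in> X. path x (Suc i) = z (Suc i)})"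
      by (intro closedin_INT closedin_path) auto
    ultimately show ?thesis by simp
  qed
  moreover have "K k \<noteq> {}" for k
  proof -
    have "z (Suc k) \<in> edge_set (Suc k)" using z by (auto simp: path_space_def B_simps)
    then obtain c where "c \<in> C" "rng B (Suc k) (z (Suc k)) = to_nat (lab c)"
      by (auto simp: edge_set_def B_simps)
    then show ?thesis using path_prefix_realized[OF z] unfolding K_def by blast
  qed
  moreover have "antimono_on UNIV K" by (auto simp: monotone_on_def K_def)
  \<comment> \<open>Compactness passes from the finite prefixes of \<open>z\<close>, each realized
    by some point, to the whole path.\<close>
  ultimately have "\<Inter> (range K) \<noteq> {}" using compact_XT compact_space_imp_nest by blast
  then obtain x where x: "\<And>k. x \<in> K k" by auto
  have "path x k = z k" for k
  proof (cases k)
    case 0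
    then show ?thesis using z by (auto simp: path_def path_space_def PiE_iff extensional_def)
  next
    case (Suc j)
    then show ?thesis using x[of j] by (simp add: K_def)
  qed
  then show ?thesis using x[of 0] by (auto simp: K_def)
qed

subsection \<open>The shift as Vershik map\<close>

text \<open>By \<open>max_edge_path\<close> this expresses that edge number \<open>k + 1\<close> of
  the path is maximal.\<close>

definition top_floor :: "(nat \<Rightarrow> 'a) \<Rightarrow> nat \<Rightarrow> bool" where
  "top_floor x k \<longleftrightarrow> off x k + width k (lab (lev x k)) (off x k) = height k (lab (lev x k))"

lemma width_Suc: "x \<in> X \<Longrightarrow> width (Suc k) (lab (lev x (Suc k))) (off x (Suc k)) = ret (lev x k)"
  using low_off[of x k] by (simp add: width_def del: off_Suc)

lemma not_top_floor:
  assumes "x \<in> X" "\<not> top_floor x k"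
  shows "off x k + width k (lab (lev x k)) (off x k) < height k (lab (lev x k))"
  using width_le[OF lab_lev[OF assms(1)] off_in_pos[OF assms(1)], of k] assms by (simp add: top_floor_def)

lemma max_edge_path: "x \<in> X \<Longrightarrow> max_edge B (Suc k) (path x (Suc k)) \<longleftrightarrow> top_floor x k"
  using max_edge_B[OF lab_lev off_in_pos] by (simp add: top_floor_def)

lemma min_edge_path: "x \<in> X \<Longrightarrow> min_edge B (Suc k) (path x (Suc k)) \<longleftrightarrow> off x k = 0"
  using min_edge_B[OF lab_lev off_in_pos] by simp

text \<open>A level at its top resets its offset and hands the step on to the level above; at level
  0 the step is the shift itself.\<close>

lemma shift_carry:
  assumes x: "x \<in> X" and "\<And>j. j \<le> k \<Longrightarrow> top_floor x j"
  shows "off (sh 1 x) k = 0 \<and> lev (sh 1 x) k = nxt (lev x k)"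
  using assms(2)
proof (induction k)
  case 0
  let ?c = "floor.base x"
  have c: "?c \<in> C" using floor.base_in_C x by blast
  have "floor.hgt x + 1 = ret ?c" using 0[of 0] by (simp add: top_floor_def width_def height_def lev_0)
  then have "sh 1 x = nxt ?c" using floor.floor_of[OF x] sh_sh[of 1 "floor.hgt x" ?c] by (simp add: nxt_def)
  moreover have "nxt ?c \<in> C" using nxt_in_C C_in_X c by blast
  ultimately show ?case using floor.base_g floor.hgt_g by (simp add: lev_0)
next
  case (Suc k)
  let ?c = "lev x k"
  have c: "?c \<in> C" using lev_in_C x by blast
  have "dt ?c + ret ?c = length (W (lab (D ?c)))"
    using Suc.prems[of "Suc k"] width_Suc[OF x, of k] by (simp add: top_floor_def height_def lev_Suc)
  then show ?case using nxt_carry[OF c] Suc by (simp add: lev_Suc)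
qed

text \<open>The first level that is not at its top receives the carry from below and absorbs
  it.\<close>

lemma shift_inner:
  assumes x: "x \<in> X" and "\<And>j. j < k \<Longrightarrow> top_floor x j" and not: "\<not> top_floor x k"
  shows "off (sh 1 x) k = off x k + width k (lab (lev x k)) (off x k) \<and> lev (sh 1 x) k = lev x k"
proof (cases k)
  case 0
  let ?c = "floor.base x"
  have c: "?c \<in> C" using floor.base_in_C x by blast
  have less: "floor.hgt x + 1 < length (lab ?c)"
    using not_top_floor[OF x not] by (simp add: 0 width_def height_def lev_0)
  have "sh 1 x = sh (floor.hgt x + 1) ?c" using floor.floor_of[OF x] sh_sh[of 1 "floor.hgt x" ?c] by simp
  then show ?thesis using floor.base_eq[OF c less] floor.hgt_eq[OF c less] by (simp add: 0 lev_0 width_def)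
next
  case (Suc j)
  let ?c = "lev x j"
  have c: "?c \<in> C" using lev_in_C x by blast
  have "dt ?c + ret ?c < length (W (lab (D ?c)))"
    using not_top_floor[OF x not] width_Suc[OF x, of j] by (simp add: Suc height_def lev_Suc)
  moreover have "lev (sh 1 x) j = nxt ?c" using shift_carry[OF x, of j] assms(2) Suc by simp
  ultimately show ?thesis using nxt_inner[OF c] width_Suc[OF x, of j] by (simp add: Suc lev_Suc)
qed

lemma shift_above:
  assumes "x \<in> X" "\<And>j. j < k \<Longrightarrow> top_floor x j" "\<not> top_floor x k" "i > k"
  shows "path (sh 1 x) (Suc i) = path x (Suc i)"
proof -
  have lev: "lev (sh 1 x) k = lev x k" using shift_inner assms by blast
  obtain j where i: "i = Suc (k + j)" using assms(4) less_iff_Suc_add by auto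
  have "lev (sh 1 x) (k + j) = lev x (k + j)" using lev by (simp only: lev_add)
  then show ?thesis by (simp add: i lev_Suc)
qed

lemma lev_y: "lev y k = y"
proof (induction k)
  case 0
  then show ?case using floor.base_g[OF y_in_C] by (simp add: lev_0)
next
  case (Suc k)
  then show ?case using level.base_g[OF y_in_C] \<theta>_y by (simp add: lev_Suc)
qed

lemma off_y: "off y k = 0"
  using floor.hgt_g[OF y_in_C] level.hgt_g[OF y_in_C] \<theta>_y by (cases k) (simp_all add: lev_y)

lemma minimal_path_y: "minimal_path B (path y)"
  unfolding minimal_path_def
proof (intro conjI allI impI path_in_path_space y_in_X)
  fix k :: nat assume "1 \<le> k"
  then show "min_edge B k (path y k)"
    using min_edge_path[OF y_in_X] off_y by (cases k) (simp_all del: path_Suc)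
qed

text \<open>If all offsets vanish, \<open>x\<close> lies in \<theta>^k(C) for every \<open>k\<close>
  and hence agrees with \<open>y\<close> on arbitrarily long prefixes.\<close>

lemma minimal_path_unique:
  assumes "minimal_path B z" shows "z = path y"
proof -
  obtain x where x: "x \<in> X" "path x = z"
    using assms path_surjective unfolding minimal_path_def by blast
  have off: "off x k = 0" for k
    using assms min_edge_path[OF x(1), of k] x(2) by (simp add: minimal_path_def del: path_Suc)
  have "(\<theta> ^^ k) (lev x k) = x" for k
  proof (induction k)
    case 0
    show ?case using floor.floor_of[OF x(1)] off[of 0] by (simp add: lev_0)
  next
    case (Suc k)
    have "\<theta> (lev x (Suc k)) = lev x k"
      using level_of[OF lev_in_C[OF x(1)], of k] off[of "Suc k"] by (simp add: lev_Suc)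
    then show ?case using Suc by (simp add: funpow_swap1)
  qed
  then have "agree m y x" for m
    using \<theta>k_agree_y[of m] lev_in_C[OF x(1)] by (metis order_refl)
  then have "y = x" by (rule eq_if_agree_all)
  then show ?thesis using x(2) by simp
qed

lemma the_minimal_path: "(THE z. minimal_path B z) = path y"
  using minimal_path_y minimal_path_unique by (rule the_equality)

lemma semi_proper_B: "semi_proper B"
  unfolding semi_proper_def
  using ordered_diagram_B simple_diagram_B minimal_path_y minimal_path_unique by blast

text \<open>A minimal edge is determined by its range, which is the source of the edge above it; so
  the induction runs downwards.\<close>

lemma minimal_below_unique:
  assumes z: "z \<in> path_space B" "z' \<in> path_space B"
    and top: "z (Suc k) = z' (Suc k)"
    and min: "\<And>i. i < k \<Longrightarrow> min_edge B (Suc i) (z (Suc i))" "\<And>i. i < k \<Longrightarrow> min_edge B (Suc i) (z' (Suc i))"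
  shows "i \<le> k \<Longrightarrow> z (Suc i) = z' (Suc i)"
proof (induction i rule: inc_induct)
  case (step i)
  have *: "rng B (Suc i) (z (Suc i)) = src B (Suc (Suc i)) (z (Suc (Suc i)))"
    if "z \<in> path_space B" for z using that by (auto simp: path_space_def)
  let ?r = "low (edge_word (z (Suc (Suc i)))) (edge_pos (z (Suc (Suc i))))"
  have "rng B (Suc i) (z (Suc i)) = to_nat ?r" "rng B (Suc i) (z' (Suc i)) = to_nat ?r"
    using *[OF z(1)] *[OF z(2)] step.IH by (simp_all add: B_simps)
  then show ?case using min_edge_eq min step.hyps by metis
qed (rule top)

lemma vershik_path:
  assumes x: "x \<in> X" shows "vershik B (path x) = path (sh 1 x)"
proof (cases "\<forall>k. top_floor x k")
  case True
  have "maximal_path B (path x)"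
    unfolding maximal_path_def
  proof (intro conjI allI impI path_in_path_space x)
    fix k :: nat assume "1 \<le> k"
    then show "max_edge B k (path x k)"
      using max_edge_path[OF x] True by (cases k) (simp_all del: path_Suc)
  qed
  \<comment> \<open>An endless carry resets every offset, in accordance with the value of
    \<open>vershik\<close> on maximal paths.\<close>
  moreover have "minimal_path B (path (sh 1 x))"
    unfolding minimal_path_def
  proof (intro conjI allI impI path_in_path_space sh_in_X x)
    fix k :: nat assume "1 \<le> k"
    then show "min_edge B k (path (sh 1 x) k)"
      using min_edge_path[OF sh_in_X[OF x]] shift_carry[OF x] True by (cases k) (simp_all del: path_Suc)
  qed
  ultimately show ?thesis
    using minimal_path_unique the_minimal_path by (simp add: vershik_def)
next
  case False
  define k where "k = (LEAST k. \<not> top_floor x k)"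
  have "\<exists>k. \<not> top_floor x k" using False by blast
  then have k: "\<not> top_floor x k" unfolding k_def by (rule LeastI_ex)
  have below: "top_floor x j" if "j < k" for j using not_less_Least that unfolding k_def by blast
  have not_max: "\<not> maximal_path B (path x)"
    using k max_edge_path[OF x, of k] by (auto simp: maximal_path_def simp del: path_Suc)
  \<comment> \<open>Levels of \<open>top_floor\<close> start at 0 and edges at 1, so the first edge
    that is not maximal has number \<open>Suc k\<close>.\<close>
  have least: "(LEAST i. i \<ge> 1 \<and> \<not> max_edge B i (path x i)) = Suc k"
  proof (rule Least_equality)
    show "1 \<le> Suc k \<and> \<not> max_edge B (Suc k) (path x (Suc k))"
      using k max_edge_path[OF x] by (simp del: path_Suc)
    fix i assume i: "1 \<le> i \<and> \<not> max_edge B i (path x i)"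
    then obtain j where "i = Suc j" by (cases i) auto
    then show "Suc k \<le> i" using i below max_edge_path[OF x, of j] by (auto simp del: path_Suc intro: leI)
  qed
  have succ: "succ_edge B (Suc k) (path x (Suc k)) = path (sh 1 x) (Suc k)"
    using succ_edge_B[OF lab_lev[OF x] off_in_pos[OF x] not_top_floor[OF x k]]
      shift_inner[OF x below k] by simp
  let ?P = "\<lambda>z. z \<in> path_space B \<and> (\<forall>i>Suc k. z i = path x i) \<and>
    z (Suc k) = succ_edge B (Suc k) (path x (Suc k)) \<and> (\<forall>i. 1 \<le> i \<and> i < Suc k \<longrightarrow> min_edge B i (z i))"
  have P: "?P (path (sh 1 x))"
  proof (intro conjI allI impI)
    show "path (sh 1 x) \<in> path_space B" using path_in_path_space sh_in_X x by blast
    show "path (sh 1 x) i = path x i" if "i > Suc k" for i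
      using that shift_above[OF x below k, of "i - 1"] by (cases i) auto
    show "path (sh 1 x) (Suc k) = succ_edge B (Suc k) (path x (Suc k))" using succ by simp
    show "min_edge B i (path (sh 1 x) i)" if "1 \<le> i \<and> i < Suc k" for i
      using that min_edge_path[OF sh_in_X[OF x]] shift_carry[OF x] below
      by (cases i) (simp_all del: path_Suc)
  qed
  have "z = path (sh 1 x)" if z: "?P z" for z
  proof
    fix i
    have low: "z (Suc j) = path (sh 1 x) (Suc j)" if "j \<le> k" for j
    proof (rule minimal_below_unique[OF _ _ _ _ _ that])
      show "z \<in> path_space B" "path (sh 1 x) \<in> path_space B" using z P by blast+
      show "z (Suc k) = path (sh 1 x) (Suc k)" using z P by simp
      show "min_edge B (Suc i) (z (Suc i))" "min_edge B (Suc i) (path (sh 1 x) (Suc i))" if "i < k" for i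
        using z P that by (simp_all del: path_Suc)
    qed
    show "z i = path (sh 1 x) i"
    proof (cases i)
      case 0
      then show ?thesis using z by (auto simp: path_def path_space_def PiE_iff extensional_def)
    next
      case (Suc j)
      then show ?thesis using low[of j] z P by (cases "j \<le> k") (simp_all del: path_Suc)
    qed
  qed
  with P have "(THE z. ?P z) = path (sh 1 x)" by (rule the_equality[where P = ?P])
  then show ?thesis using not_max by (simp only: vershik_def least Let_def if_False)
qed

subsection \<open>The conjugacy\<close>

lemma topspace_path_topology: "topspace (path_topology B) = path_space B"
  by (auto simp: path_topology_def path_space_def)

text \<open>A continuous bijection from a compact space onto a Hausdorff space; continuity is
  checked one edge at a time.\<close>

lemma homeomorphic_map_path: "homeomorphic_map XT (path_topology B) path"
proof (rule continuous_imp_homeomorphic_map)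
  show "continuous_map XT (path_topology B) path"
    unfolding path_topology_def continuous_map_in_subtopology continuous_map_componentwise
  proof (intro conjI ballI)
    show "path ` topspace XT \<subseteq> extensional {1..}"
      by (auto simp: path_def extensional_def)
    show "continuous_map XT (discrete_topology (edges B k)) (\<lambda>x. path x k)" if "k \<in> {1..}" for k
    proof -
      obtain j where k: "k = Suc j" using \<open>k \<in> {1..}\<close> by (cases k) auto
      have "path x k \<in> edges B k" if "x \<in> X" for x
      proof -
        have "path x \<in> Pi\<^sub>E {1..} (edges B)"
          using path_in_path_space[OF that] unfolding path_space_def by blast
        then show ?thesis by (rule PiE_mem) (simp add: k)
      qed
      then show ?thesis
        unfolding continuous_map_closedin k using closedin_path by auto
    qed
    show "path \<in> topspace XT \<rightarrow> path_space B" using path_in_path_space by auto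
  qed
  show "Hausdorff_space (path_topology B)"
    unfolding path_topology_def
    by (intro Hausdorff_space_subtopology) (simp add: Hausdorff_space_product_topology)
  show "path ` topspace XT = topspace (path_topology B)"
    using path_in_path_space path_surjective by (auto simp: topspace_path_topology)
  show "inj_on path (topspace XT)" using path_injective by (auto intro: inj_onI)
qed (rule compact_XT)

lemma conjugate_B: "topologically_conjugate (path_topology B) (vershik B) XT shift"
proof -
  \<comment> \<open>\<open>path\<close> leads from the subshift to the diagram, but the conjugacy is
    wanted in the other direction.\<close>
  obtain g where g: "homeomorphic_maps XT (path_topology B) path g"
    using homeomorphic_map_path homeomorphic_map_maps by blast
  then have "homeomorphic_map (path_topology B) XT g"
    using homeomorphic_maps_sym homeomorphic_map_maps by blast
  moreover have "g (vershik B z) = shift (g z)" if z: "z \<in> topspace (path_topology B)" for z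
  proof -
    obtain x where x: "x \<in> X" "path x = z" using z path_surjective topspace_path_topology by blast
    have inv: "g (path x) = x" if "x \<in> X" for x using g that by (simp add: homeomorphic_maps_def)
    show ?thesis using vershik_path[OF x(1)] inv x sh_in_X[OF x(1), of 1] by (metis shift_eq_sh)
  qed
  ultimately show ?thesis unfolding topologically_conjugate_def by blast
qed

end

theorem theorem18:
  fixes \<tau> :: "'a::finite \<Rightarrow> 'a list" and u y :: "nat \<Rightarrow> 'a" and M :: nat
  assumes "substitution \<tau>"
    and "reasonable \<tau> u"
    and "generating_fixed_point \<tau> u"
    and "M_quasi_invertible M \<tau>"
    and "branch_point (subshift_topology \<tau>) shift y"
  shows "\<exists>B :: (nat, nat) ordered_bratteli.
           semi_proper B \<and> stationary B \<and>
           topologically_conjugate (path_topology B) (vershik B) (subshift_topology \<tau>) shift"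
proof -
  have "inj (subst_pow \<tau> 1)" using assms(2) by (simp add: reasonable_def)
  moreover have "subst_pow \<tau> 1 = \<tau>" by (simp add: subst_pow_def fun_eq_iff)
  ultimately have "branching_substitution \<tau> u y"
    using assms unfolding branching_substitution_def reasonable_def minimal_substitution_def
      M_quasi_invertible_def quasi_invertible_def by auto
  then interpret branching_substitution \<tau> u y .
  obtain s where "y = s @- T y" "\<forall>b. [b] @- y \<in> X \<longrightarrow> (\<exists>g. \<tau> b = g @ s)"
    using ex_common_suffix by blast
  moreover obtain n where
    "\<forall>b. b # factor y 0 n \<in> factors u \<longrightarrow> [b] @- y \<in> X" "u 0 \<in> set (factor y 0 n)"
    using ex_prefix_length by blast
  ultimately interpret return_system \<tau> u y s n by unfold_locales blast+
  show ?thesis using semi_proper_B stationary_B conjugate_B by blast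
qed

end
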